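(* Let $\mathbf r(x,y)$ be the position vector of a pseudospherical surface in the Dini parameterisation, with Chebyshev angle $\phi$ and unit normal $\mathbf n$. Let $\Psi$ be any solution of the Moutard equation $\Psi_{xy}=\Psi\cos\phi$. Let $$\tilde X=\frac{\phi_x}{\sin\phi}\Psi_y-\Psi,\qquad \tilde Y=\frac{\phi_y}{\tan\phi}\Psi_y-\Psi_{yy}.$$ (i) Introduce a vector $\tilde{\mathbf r}$ by $$\tilde{\mathbf r}_x=\frac{\tilde X}{\sin\phi}\,\mathbf r_y,\qquad \tilde{\mathbf r}_y=\frac{\tilde Y}{\sin\phi}\,\mathbf r_x .$$ Then the net $\tilde{\mathbf r}(x,y)$, if nonsingular, is a Voss net. The corresponding fundamental forms are $$\tilde{\mathrm I}=\frac{\tilde X^2\,dx^2+2\tilde X\tilde Y\cos\phi\,dx\,dy+\tilde Y^2\,dy^2}{\sin^2\phi},\qquad \tilde{\mathrm{II}}=\tilde X\,dx^2+\tilde Y\,dy^2 .$$ (ii) The singular points $\det\tilde{\mathrm I}=0$ of $\tilde{\mathbf r}$ are determined by $\tilde X\tilde Y=0$. (iii) The functions $\tilde X,\tilde Y$ obtained for $\Psi=\mathcal R\Phi+\Phi$, where $\Phi$ is a solution of the Moutard equation $\Phi_{xy}=\Phi\cos\phi$, coincide with the functions $$X=\Phi_{xx}+\Phi-\Big(\frac{\Phi_x}{\tan\phi}+\frac{\Phi_y}{\sin\phi}\Big)\phi_x,\qquad Y=\Phi_{yy}+\Phi-\Big(\frac{\Phi_y}{\tan\phi}+\frac{\Phi_x}{\sin\phi}\Big)\phi_y$$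 obtained for $\Phi$.
   Context: All functions are smooth. A pseudospherical surface in Dini's parameterisation with Chebyshev angle $\phi$ is a surface $\mathbf r(x,y)$ in $\mathbb R^3$ with unit normal $\mathbf n$ whose fundamental forms are $\mathrm I=dx^2+2\cos\phi\,dx\,dy+dy^2$, $\mathrm{II}=2\sin\phi\,dx\,dy$. Then $\phi$ satisfies the sine-Gordon equation $\phi_{xy}=\sin\phi$, and the Gauss–Weingarten equations are $$\mathbf r_{xx}=\tfrac{\phi_x}{\tan\phi}\mathbf r_x-\tfrac{\phi_x}{\sin\phi}\mathbf r_y,\quad \mathbf r_{xy}=\sin\phi\,\mathbf n,\quad \mathbf r_{yy}=-\tfrac{\phi_y}{\sin\phi}\mathbf r_x+\tfrac{\phi_y}{\tan\phi}\mathbf r_y,$$ $$\mathbf n_x=\tfrac1{\tan\phi}\mathbf r_x-\tfrac1{\sin\phi}\mathbf r_y,\quad \mathbf n_y=\tfrac1{\tan\phi}\mathbf r_y-\tfrac1{\sin\phi}\mathbf r_x .$$ A Voss net is a conjugate net (its second fundamental form is diagonal, $\mathrm{II}_{12}=0$) formed by geodesics. The second fundamental form of $\tilde{\mathbf r}$ is taken with respect to $\mathbf n$, which is also normal to $\tilde{\mathbf r}$. $\mathcal R$ is the (multivalued) recursion operator $\mathcal R\Phi=\Phi_{xx}+\phi_xQ$, where $Q$ is a function satisfying $Q_x=\Phi_x\phi_x$, $Q_y=\Phi\sin\phi$ (determined up to an additive constant). The functions $X,Y$ in (iii) are those of the Voss net associated with $\Phi$, namely $\mathbf q=\Phi\,\mathbf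 n-\dfrac{\Phi_y\mathbf r_x+\Phi_x\mathbf r_y}{\sin\phi}$, which satisfies $\mathbf q_x=-\dfrac{X}{\sin\phi}\mathbf r_y$, $\mathbf q_y=-\dfrac{Y}{\sin\phi}\mathbf r_x$.
   Formalization: In (iii), the functions coincide only up to sign: with the printed formulas one has X̃ = −X and Ỹ = −Y (literal equality would force X = Y = 0), and this corrected relation is what is proved. *)

theory Defs
  imports "HOL-Analysis.Analysis"
begin

definition pdx :: "(real \<times> real \<Rightarrow> 'a::real_normed_vector) \<Rightarrow> real \<times> real \<Rightarrow> 'a" where
  "pdx f = (\<lambda>(x, y). vector_derivative (\<lambda>t. f (t, y)) (at x))"

definition pdy :: "(real \<times> real \<Rightarrow> 'a::real_normed_vector) \<Rightarrow> real \<times> real \<Rightarrow> 'a" where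
  "pdy f = (\<lambda>(x, y). vector_derivative (\<lambda>t. f (x, t)) (at y))"

text \<open>Class \<open>C\<^sup>k\<close>; only used on open sets.\<close>

primrec Ck_on :: "nat \<Rightarrow> (real \<times> real) set \<Rightarrow> (real \<times> real \<Rightarrow> 'a::real_normed_vector) \<Rightarrow> bool" where
  "Ck_on 0 U f = continuous_on U f"
| "Ck_on (Suc k) U f =
     ((\<forall>p\<in>U. f differentiable (at p)) \<and> Ck_on k U (pdx f) \<and> Ck_on k U (pdy f))"

definition smooth_on :: "(real \<times> real) set \<Rightarrow> (real \<times> real \<Rightarrow> 'a::real_normed_vector) \<Rightarrow> bool" where
  "smooth_on U f \<longleftrightarrow> (\<forall>k. Ck_on k U f)"

text \<open>A quadratic form \<open>E dx\<^sup>2 + 2 F dx dy + G dy\<^sup>2\<close> is represented by its symmetric matrix.\<close>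

definition quad_form :: "real \<Rightarrow> real \<Rightarrow> real \<Rightarrow> real^2^2" where
  "quad_form E F G = vector [vector [E, F], vector [F, G]]"

definition first_form :: "(real \<times> real \<Rightarrow> real^3) \<Rightarrow> real \<times> real \<Rightarrow> real^2^2" where
  "first_form f p =
     vector [vector [pdx f p \<bullet> pdx f p, pdx f p \<bullet> pdy f p],
             vector [pdy f p \<bullet> pdx f p, pdy f p \<bullet> pdy f p]]"

definition second_form ::
  "(real \<times> real \<Rightarrow> real^3) \<Rightarrow> (real \<times> real \<Rightarrow> real^3) \<Rightarrow> real \<times> real \<Rightarrow> real^2^2" where
  "second_form f N p =
     vector [vector [pdx (pdx f) p \<bullet> N p, pdy (pdx f) p \<bullet> N p],
             vector [pdx (pdy f) p \<bullet> N p, pdy (pdy f) p \<bullet> N p]]"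

definition unit_normal ::
  "(real \<times> real) set \<Rightarrow> (real \<times> real \<Rightarrow> real^3) \<Rightarrow> (real \<times> real \<Rightarrow> real^3) \<Rightarrow> bool" where
  "unit_normal U f N \<longleftrightarrow> smooth_on U N \<and>
     (\<forall>p\<in>U. norm (N p) = 1 \<and> N p \<bullet> pdx f p = 0 \<and> N p \<bullet> pdy f p = 0)"

definition nonsingular_net :: "(real \<times> real) set \<Rightarrow> (real \<times> real \<Rightarrow> real^3) \<Rightarrow> bool" where
  "nonsingular_net U f \<longleftrightarrow> smooth_on U f \<and> (\<forall>p\<in>U. det (first_form f p) \<noteq> 0)"

text \<open>
  Nonsingularity of the surface amounts to \<open>sin \<phi> \<noteq> 0\<close>; no sign of \<open>sin \<phi>\<close> is imposed.
\<close>

definition pseudospherical ::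
  "(real \<times> real) set \<Rightarrow> (real \<times> real \<Rightarrow> real) \<Rightarrow> (real \<times> real \<Rightarrow> real^3) \<Rightarrow>
   (real \<times> real \<Rightarrow> real^3) \<Rightarrow> bool" where
  "pseudospherical U \<phi> r n \<longleftrightarrow>
     smooth_on U \<phi> \<and> nonsingular_net U r \<and> unit_normal U r n \<and>
     (\<forall>p\<in>U. first_form r p = quad_form 1 (cos (\<phi> p)) 1 \<and>
             second_form r n p = quad_form 0 (sin (\<phi> p)) 0)"

text \<open>
  Geodesic curvature at parameter \<open>t\<close> of a curve on a surface with unit normal \<open>\<nu>\<close> at that
  point. Its vanishing means that the curve is a geodesic up to reparameterisation, which is
  the sense relevant to coordinate lines of a net.
\<close>

definition geodesic_curvature :: "(real \<Rightarrow> real^3) \<Rightarrow> real^3 \<Rightarrow> real \<Rightarrow> real" where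
  "geodesic_curvature c \<nu> t =
     (let c1 = (\<lambda>s. vector_derivative c (at s));
          c2 = vector_derivative c1 (at t)
      in (cross3 (c1 t) c2 \<bullet> \<nu>) / norm (c1 t) ^ 3)"

definition geodesic_net ::
  "(real \<times> real) set \<Rightarrow> (real \<times> real \<Rightarrow> real^3) \<Rightarrow> (real \<times> real \<Rightarrow> real^3) \<Rightarrow> bool" where
  "geodesic_net U f N \<longleftrightarrow>
     (\<forall>x y. (x, y) \<in> U \<longrightarrow>
        geodesic_curvature (\<lambda>s. f (s, y)) (N (x, y)) x = 0 \<and>
        geodesic_curvature (\<lambda>s. f (x, s)) (N (x, y)) y = 0)"

definition conjugate_net ::
  "(real \<times> real) set \<Rightarrow> (real \<times> real \<Rightarrow> real^3) \<Rightarrow> (real \<times> real \<Rightarrow> real^3) \<Rightarrow> bool" where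
  "conjugate_net U f N \<longleftrightarrow> (\<forall>p\<in>U. second_form f N p $ 1 $ 2 = 0)"

definition voss_net ::
  "(real \<times> real) set \<Rightarrow> (real \<times> real \<Rightarrow> real^3) \<Rightarrow> (real \<times> real \<Rightarrow> real^3) \<Rightarrow> bool" where
  "voss_net U f N \<longleftrightarrow>
     nonsingular_net U f \<and> unit_normal U f N \<and> conjugate_net U f N \<and> geodesic_net U f N"

definition moutard_solution ::
  "(real \<times> real) set \<Rightarrow> (real \<times> real \<Rightarrow> real) \<Rightarrow> (real \<times> real \<Rightarrow> real) \<Rightarrow> bool" where
  "moutard_solution U \<phi> \<Psi> \<longleftrightarrow>
     smooth_on U \<Psi> \<and> (\<forall>p\<in>U. pdy (pdx \<Psi>) p = \<Psi> p * cos (\<phi> p))"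

text \<open>
  Here and below \<open>1 / tan \<phi>\<close> is written \<open>cot \<phi>\<close>, which is \<open>cos \<phi> / sin \<phi>\<close> and
  thus also has the intended value where \<open>cos \<phi> = 0\<close>.
\<close>

definition tilde_X :: "(real \<times> real \<Rightarrow> real) \<Rightarrow> (real \<times> real \<Rightarrow> real) \<Rightarrow> real \<times> real \<Rightarrow> real" where
  "tilde_X \<phi> \<Psi> p = pdx \<phi> p / sin (\<phi> p) * pdy \<Psi> p - \<Psi> p"

definition tilde_Y :: "(real \<times> real \<Rightarrow> real) \<Rightarrow> (real \<times> real \<Rightarrow> real) \<Rightarrow> real \<times> real \<Rightarrow> real" where
  "tilde_Y \<phi> \<Psi> p = pdy \<phi> p * cot (\<phi> p) * pdy \<Psi> p - pdy (pdy \<Psi>) p"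

definition tilde_net ::
  "(real \<times> real) set \<Rightarrow> (real \<times> real \<Rightarrow> real) \<Rightarrow> (real \<times> real \<Rightarrow> real^3) \<Rightarrow>
   (real \<times> real \<Rightarrow> real) \<Rightarrow> (real \<times> real \<Rightarrow> real^3) \<Rightarrow> bool" where
  "tilde_net V \<phi> r \<Psi> f \<longleftrightarrow> smooth_on V f \<and>
     (\<forall>p\<in>V. pdx f p = (tilde_X \<phi> \<Psi> p / sin (\<phi> p)) *\<^sub>R pdy r p \<and>
             pdy f p = (tilde_Y \<phi> \<Psi> p / sin (\<phi> p)) *\<^sub>R pdx r p)"

text \<open>
  The multivalued recursion operator, as a relation: \<open>R\<close> is one of the values of
  \<open>\<R> \<Phi>\<close>, the choice being that of \<open>Q\<close>.
\<close>

definition recursion_value ::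
  "(real \<times> real) set \<Rightarrow> (real \<times> real \<Rightarrow> real) \<Rightarrow> (real \<times> real \<Rightarrow> real) \<Rightarrow>
   (real \<times> real \<Rightarrow> real) \<Rightarrow> bool" where
  "recursion_value U \<phi> \<Phi> R \<longleftrightarrow>
     (\<exists>Q. smooth_on U Q \<and>
        (\<forall>p\<in>U. pdx Q p = pdx \<Phi> p * pdx \<phi> p \<and> pdy Q p = \<Phi> p * sin (\<phi> p)) \<and>
        (\<forall>p\<in>U. R p = pdx (pdx \<Phi>) p + pdx \<phi> p * Q p))"

text \<open>
  The net \<open>q\<close> associated with \<open>\<Phi>\<close> has derivatives \<open>q\<^sub>x = - (X / sin \<phi>) r\<^sub>y\<close> and
  \<open>q\<^sub>y = - (Y / sin \<phi>) r\<^sub>x\<close>, with the sign opposite to that used in \<open>tilde_net\<close>.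
\<close>

definition voss_X :: "(real \<times> real \<Rightarrow> real) \<Rightarrow> (real \<times> real \<Rightarrow> real) \<Rightarrow> real \<times> real \<Rightarrow> real" where
  "voss_X \<phi> \<Phi> p =
     pdx (pdx \<Phi>) p + \<Phi> p - (pdx \<Phi> p * cot (\<phi> p) + pdy \<Phi> p / sin (\<phi> p)) * pdx \<phi> p"

definition voss_Y :: "(real \<times> real \<Rightarrow> real) \<Rightarrow> (real \<times> real \<Rightarrow> real) \<Rightarrow> real \<times> real \<Rightarrow> real" where
  "voss_Y \<phi> \<Phi> p =
     pdy (pdy \<Phi>) p + \<Phi> p - (pdy \<Phi> p * cot (\<phi> p) + pdx \<Phi> p / sin (\<phi> p)) * pdy \<phi> p"

definition voss_q ::
  "(real \<times> real \<Rightarrow> real) \<Rightarrow> (real \<times> real \<Rightarrow> real^3) \<Rightarrow> (real \<times> real \<Rightarrow> real^3) \<Rightarrow>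
   (real \<times> real \<Rightarrow> real) \<Rightarrow> real \<times> real \<Rightarrow> real^3" where
  "voss_q \<phi> r n \<Phi> p =
     \<Phi> p *\<^sub>R n p - (1 / sin (\<phi> p)) *\<^sub>R (pdy \<Phi> p *\<^sub>R pdx r p + pdx \<Phi> p *\<^sub>R pdy r p)"

end

theory Submission
  imports Defs
begin

text \<open>
  Expanding in the frame \<open>r\<^sub>x, r\<^sub>y, n\<close> recovers the Gauss--Weingarten equations from the fundamental
  forms, and \<open>r\<^sub>x\<^sub>x\<^sub>y = r\<^sub>x\<^sub>y\<^sub>x\<close> then gives \<open>\<phi>\<^sub>x\<^sub>y = sin \<phi>\<close>. For a Moutard solution the tilde
  functions satisfy \<open>X\<^sub>y = - Y \<phi>\<^sub>x / sin \<phi>\<close>, \<open>Y\<^sub>x = - X \<phi>\<^sub>y / sin \<phi>\<close>, which is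
  exactly closedness of the form \<open>(X r\<^sub>y dx + Y r\<^sub>x dy) / sin \<phi>\<close>; the net is its potential. Since
  \<open>r\<^sub>y\<^sub>y\<close> and \<open>r\<^sub>x\<^sub>x\<close> are tangential and \<open>r\<^sub>x\<^sub>y\<close> is normal, the fundamental forms can be read off, and
  \<open>f\<^sub>x\<^sub>x\<close> lies in the span of \<open>f\<^sub>x\<close> and \<open>n\<close>, so that the coordinate lines are geodesics. For (iii), the
  key identity is \<open>\<Psi>\<^sub>y = \<Phi>\<^sub>x cos \<phi> + Q sin \<phi> + \<Phi>\<^sub>y\<close>: all terms with \<open>Q\<close> cancel from \<open>X\<close> and \<open>Y\<close>.
\<close>

section \<open>Calculus of partial derivatives\<close>

text \<open>Total differentiability with prescribed partials. Since \<open>pdx\<close> and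
  \<open>pdy\<close> have some value even where nothing is differentiable, derivative rules are
  stated with this predicate, and the values of \<open>pdx\<close> and \<open>pdy\<close> are read
  off at the end.\<close>

definition has_partials ::
  "(real \<times> real \<Rightarrow> 'a::real_normed_vector) \<Rightarrow> 'a \<Rightarrow> 'a \<Rightarrow> real \<times> real \<Rightarrow> bool" where
  "has_partials f a b p \<longleftrightarrow> (f has_derivative (\<lambda>h. fst h *\<^sub>R a + snd h *\<^sub>R b)) (at p)"

lemma has_partials_slice_x:
  assumes "has_partials f a b (x, y)"
  shows "((\<lambda>t. f (t, y)) has_vector_derivative a) (at x)"
proof -
  have "((\<lambda>t. (t, y)) has_derivative (\<lambda>h. (h, 0))) (at x)"
    by (auto intro!: derivative_eq_intros)
  moreover have "(f has_derivative (\<lambda>h. fst h *\<^sub>R a + snd h *\<^sub>R b)) (at ((\<lambda>t. (t, y)) x))"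
    using assms by (simp add: has_partials_def)
  ultimately show ?thesis
    unfolding has_vector_derivative_def
    by (rule has_derivative_compose[THEN has_derivative_eq_rhs]) auto
qed

lemma has_partials_slice_y:
  assumes "has_partials f a b (x, y)"
  shows "((\<lambda>t. f (x, t)) has_vector_derivative b) (at y)"
proof -
  have "((\<lambda>t. (x, t)) has_derivative (\<lambda>h. (0, h))) (at y)"
    by (auto intro!: derivative_eq_intros)
  moreover have "(f has_derivative (\<lambda>h. fst h *\<^sub>R a + snd h *\<^sub>R b)) (at ((\<lambda>t. (x, t)) y))"
    using assms by (simp add: has_partials_def)
  ultimately show ?thesis
    unfolding has_vector_derivative_def
    by (rule has_derivative_compose[THEN has_derivative_eq_rhs]) auto
qed

lemma has_partials_imp_pdx: "has_partials f a b p \<Longrightarrow> pdx f p = a"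
  using has_partials_slice_x[of f a b "fst p" "snd p"]
  by (simp add: pdx_def split_beta vector_derivative_at)

lemma has_partials_imp_pdy: "has_partials f a b p \<Longrightarrow> pdy f p = b"
  using has_partials_slice_y[of f a b "fst p" "snd p"]
  by (simp add: pdy_def split_beta vector_derivative_at)

text \<open>A linear map on the plane is determined by its values at \<open>(1, 0)\<close> and
  \<open>(0, 1)\<close>, and restriction to the slices identifies these with the partial
  derivatives. This links \<open>Ck_on\<close> with \<open>has_partials\<close>.\<close>

lemma differentiable_iff_has_partials:
  "f differentiable (at p) \<longleftrightarrow> has_partials f (pdx f p) (pdy f p) p"
proof
  assume "f differentiable (at p)"
  then obtain D where D: "(f has_derivative D) (at p)"
    by (auto simp: differentiable_def)
  interpret bounded_linear D using D by (rule has_derivative_bounded_linear)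
  have "D h = fst h *\<^sub>R D (1, 0) + snd h *\<^sub>R D (0, 1)" for h
  proof -
    have "D h = D (fst h *\<^sub>R (1, 0) + snd h *\<^sub>R (0, 1))" by simp
    then show ?thesis by (simp only: add scaleR)
  qed
  then have "D = (\<lambda>h. fst h *\<^sub>R D (1, 0) + snd h *\<^sub>R D (0, 1))" by (rule ext)
  from has_derivative_eq_rhs[OF D this] have hp: "has_partials f (D (1, 0)) (D (0, 1)) p"
    unfolding has_partials_def .
  from this show "has_partials f (pdx f p) (pdy f p) p"
    using has_partials_imp_pdx[OF hp] has_partials_imp_pdy[OF hp] by simp
qed (auto simp: has_partials_def differentiable_def)

lemma has_partials_imp_differentiable: "has_partials f a b p \<Longrightarrow> f differentiable (at p)"
  by (auto simp: has_partials_def differentiable_def)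

lemma has_partials_cong:
  assumes "has_partials f a b p" "open U" "p \<in> U" "\<And>q. q \<in> U \<Longrightarrow> f q = g q"
  shows "has_partials g a b p"
  using assms has_derivative_transform_within_open unfolding has_partials_def by blast

lemma has_partials_const: "has_partials (\<lambda>p. c) 0 0 p"
  by (simp add: has_partials_def)

lemma has_partials_add:
  "has_partials f a b p \<Longrightarrow> has_partials g c d p \<Longrightarrow>
    has_partials (\<lambda>p. f p + g p) (a + c) (b + d) p"
  unfolding has_partials_def
  by (rule has_derivative_eq_rhs, erule (1) has_derivative_add) (auto simp: algebra_simps)

lemma has_partials_minus:
  "has_partials f a b p \<Longrightarrow> has_partials (\<lambda>p. - f p) (- a) (- b) p"
  unfolding has_partials_def
  by (rule has_derivative_eq_rhs, erule has_derivative_minus) auto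

lemma has_partials_diff:
  "has_partials f a b p \<Longrightarrow> has_partials g c d p \<Longrightarrow>
    has_partials (\<lambda>p. f p - g p) (a - c) (b - d) p"
  unfolding has_partials_def
  by (rule has_derivative_eq_rhs, erule (1) has_derivative_diff) (auto simp: algebra_simps)

text \<open>One product rule that serves multiplication, scaling and the inner product.\<close>

lemma has_partials_bilinear:
  assumes "bounded_bilinear mul" "has_partials f a b p" "has_partials g c d p"
  shows "has_partials (\<lambda>p. mul (f p) (g p)) (mul a (g p) + mul (f p) c) (mul b (g p) + mul (f p) d) p"
proof -
  interpret bounded_bilinear mul by fact
  show ?thesis
    using assms unfolding has_partials_def
    by (intro has_derivative_eq_rhs[OF FDERIV])
       (auto simp: add_left add_right scaleR_left scaleR_right algebra_simps)
qed

lemmas has_partials_mult = has_partials_bilinear[OF bounded_bilinear_mult]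
lemmas has_partials_scaleR = has_partials_bilinear[OF bounded_bilinear_scaleR]
lemmas has_partials_inner = has_partials_bilinear[OF bounded_bilinear_inner]

lemma has_partials_compose:
  assumes "(h has_real_derivative d) (at (f p))" "has_partials f a b p"
  shows "has_partials (\<lambda>p. h (f p)) (d * a) (d * b) p"
proof -
  have "(h has_derivative (\<lambda>x. x * d)) (at (f p))"
    using assms(1) by (simp add: has_field_derivative_def mult_commute_abs)
  with assms(2) show ?thesis
    unfolding has_partials_def
    by (rule has_derivative_compose[THEN has_derivative_eq_rhs]) (auto simp: algebra_simps)
qed

lemma has_partials_sin:
  fixes f :: "real \<times> real \<Rightarrow> real"
  shows "has_partials f a b p \<Longrightarrow> has_partials (\<lambda>p. sin (f p)) (cos (f p) * a) (cos (f p) * b) p"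
  by (rule has_partials_compose[where h = sin, OF DERIV_sin])

lemma has_partials_cos:
  fixes f :: "real \<times> real \<Rightarrow> real"
  shows "has_partials f a b p \<Longrightarrow> has_partials (\<lambda>p. cos (f p)) (- sin (f p) * a) (- sin (f p) * b) p"
  by (rule has_partials_compose[where h = cos, OF DERIV_cos])

lemma has_partials_inverse:
  fixes f :: "real \<times> real \<Rightarrow> real"
  shows "has_partials f a b p \<Longrightarrow> f p \<noteq> 0 \<Longrightarrow>
    has_partials (\<lambda>p. inverse (f p)) (- (inverse (f p))\<^sup>2 * a) (- (inverse (f p))\<^sup>2 * b) p"
  by (rule has_partials_compose[OF DERIV_inverse[unfolded One_nat_def[symmetric], THEN DERIV_cong]])
     (auto simp: power2_eq_square)

section \<open>Closure properties of the classes \<open>Ck_on\<close>\<close>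

lemma Ck_on_cong:
  assumes "Ck_on k U f" "open U" "\<And>p. p \<in> U \<Longrightarrow> f p = g p"
  shows "Ck_on k U g"
  using assms
proof (induction k arbitrary: f g)
  case 0
  then show ?case by (simp cong: continuous_on_cong)
next
  case (Suc k)
  have g: "has_partials g (pdx f p) (pdy f p) p" if "p \<in> U" for p
  proof (rule has_partials_cong)
    show "has_partials f (pdx f p) (pdy f p) p"
      using Suc.prems(1) that by (simp add: differentiable_iff_has_partials)
  qed (use Suc.prems that in auto)
  have "Ck_on k U (pdx g)"
    by (rule Suc.IH[of "pdx f"])
      (use Suc.prems has_partials_imp_pdx[OF g] in simp_all)
  moreover have "Ck_on k U (pdy g)"
    by (rule Suc.IH[of "pdy f"])
      (use Suc.prems has_partials_imp_pdy[OF g] in simp_all)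
  ultimately show ?case
    using has_partials_imp_differentiable[OF g] by simp
qed

text \<open>This is the induction step of the closure properties below: a rule for
  \<open>has_partials\<close> supplies formulas for the partials, valid on \<open>U\<close>, and the
  induction hypothesis shows that these formulas are of class \<open>Ck_on k\<close>.\<close>

lemma Ck_on_SucI:
  assumes "open U" "\<And>p. p \<in> U \<Longrightarrow> has_partials f (a p) (b p) p" "Ck_on k U a" "Ck_on k U b"
  shows "Ck_on (Suc k) U f"
proof -
  have "pdx f p = a p" "pdy f p = b p" if "p \<in> U" for p
    using has_partials_imp_pdx[OF assms(2)[OF that]] has_partials_imp_pdy[OF assms(2)[OF that]]
    by auto
  then have "Ck_on k U (pdx f)" "Ck_on k U (pdy f)"
    using Ck_on_cong[OF assms(3,1), of "pdx f"] Ck_on_cong[OF assms(4,1), of "pdy f"] by simp_all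
  then show ?thesis
    using has_partials_imp_differentiable[OF assms(2)] by simp
qed

text \<open>Continuity is demanded only at the bottom of the recursion, so lowering the order needs
  an induction; at order 0 differentiability gives continuity.\<close>

lemma Ck_on_SucD: "Ck_on (Suc k) U f \<Longrightarrow> Ck_on k U f"
proof (induction k arbitrary: f)
  case 0
  have "isCont f p" if "p \<in> U" for p
    by (rule differentiable_imp_continuous_within) (use 0 that in simp)
  then show ?case
    by (simp add: continuous_at_imp_continuous_on)
next
  case (Suc k)
  have "\<forall>p\<in>U. f differentiable (at p)" "Ck_on (Suc k) U (pdx f)" "Ck_on (Suc k) U (pdy f)"
    using Suc.prems by simp_all
  with this(2,3)[THEN Suc.IH] show ?case by simp
qed

lemma Ck_on_Suc_has_partials:
  "Ck_on (Suc k) U f \<Longrightarrow> p \<in> U \<Longrightarrow> has_partials f (pdx f p) (pdy f p) p"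
  by (simp add: differentiable_iff_has_partials)

lemma Ck_on_subset: "Ck_on k U f \<Longrightarrow> V \<subseteq> U \<Longrightarrow> Ck_on k V f"
  by (induction k arbitrary: f) (auto intro: continuous_on_subset)

lemma Ck_on_const: "open U \<Longrightarrow> Ck_on k U (\<lambda>p. c)"
proof (induction k arbitrary: c)
  case (Suc k)
  show ?case
    by (intro Ck_on_SucI[OF Suc.prems has_partials_const] Suc)
qed simp

lemma Ck_on_add:
  "open U \<Longrightarrow> Ck_on k U f \<Longrightarrow> Ck_on k U g \<Longrightarrow> Ck_on k U (\<lambda>p. f p + g p)"
proof (induction k arbitrary: f g)
  case (Suc k)
  have "Ck_on k U (pdx f)" "Ck_on k U (pdy f)" "Ck_on k U (pdx g)" "Ck_on k U (pdy g)"
    using Suc.prems by auto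
  then show ?case
    by (intro Ck_on_SucI[OF Suc.prems(1) has_partials_add[OF
          Ck_on_Suc_has_partials[OF Suc.prems(2)] Ck_on_Suc_has_partials[OF Suc.prems(3)]]]
        Suc.IH Suc.prems)
qed (auto intro: continuous_intros)

lemma Ck_on_bilinear:
  assumes "bounded_bilinear mul" "open U"
  shows "Ck_on k U f \<Longrightarrow> Ck_on k U g \<Longrightarrow> Ck_on k U (\<lambda>p. mul (f p) (g p))"
proof (induction k arbitrary: f g)
  case 0
  then show ?case using bounded_bilinear.continuous_on[OF assms(1)] by auto
next
  case (Suc k)
  have "Ck_on k U (pdx f)" "Ck_on k U (pdy f)" "Ck_on k U (pdx g)" "Ck_on k U (pdy g)"
    "Ck_on k U f" "Ck_on k U g"
    using Suc.prems Ck_on_SucD by auto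
  then show ?case
    by (intro Ck_on_SucI[OF assms(2) has_partials_bilinear[OF assms(1)
          Ck_on_Suc_has_partials[OF Suc.prems(1)] Ck_on_Suc_has_partials[OF Suc.prems(2)]]]
        Ck_on_add[OF assms(2)] Suc.IH)
qed

text \<open>Both functions are treated in one induction because the derivative of each involves the
  other.\<close>

lemma Ck_on_sin_cos:
  assumes "open U"
  shows "Ck_on k U f \<Longrightarrow> Ck_on k U (\<lambda>p. sin (f p)) \<and> Ck_on k U (\<lambda>p. cos (f p) :: real)"
proof (induction k)
  case 0
  then show ?case by (auto intro: continuous_intros)
next
  case (Suc k)
  then have IH: "Ck_on k U (\<lambda>p. sin (f p))" "Ck_on k U (\<lambda>p. cos (f p))"
    and f: "Ck_on k U (pdx f)" "Ck_on k U (pdy f)"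
    using Ck_on_SucD by auto
  have "Ck_on k U (\<lambda>p. - sin (f p))"
    using Ck_on_bilinear[OF bounded_bilinear_mult assms Ck_on_const[OF assms, of _ "-1"] IH(1)]
    by simp
  with IH f show ?case
    by (intro conjI Ck_on_SucI[OF assms has_partials_sin[OF Ck_on_Suc_has_partials[OF Suc.prems]]]
        Ck_on_SucI[OF assms has_partials_cos[OF Ck_on_Suc_has_partials[OF Suc.prems]]]
        Ck_on_bilinear[OF bounded_bilinear_mult assms])
qed

lemma Ck_on_inverse:
  fixes f :: "real \<times> real \<Rightarrow> real"
  assumes "open U" "\<And>p. p \<in> U \<Longrightarrow> f p \<noteq> 0"
  shows "Ck_on k U f \<Longrightarrow> Ck_on k U (\<lambda>p. inverse (f p))"
proof (induction k)
  case 0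
  then show ?case using assms by (auto intro: continuous_intros)
next
  case (Suc k)
  then have IH: "Ck_on k U (\<lambda>p. inverse (f p))"
    and f: "Ck_on k U (pdx f)" "Ck_on k U (pdy f)"
    using Ck_on_SucD by auto
  note mult = Ck_on_bilinear[OF bounded_bilinear_mult assms(1)]
  have "Ck_on k U (\<lambda>p. - (inverse (f p))\<^sup>2)"
    using mult[OF Ck_on_const[OF assms(1), of _ "-1"] mult[OF IH IH]]
    by (simp add: power2_eq_square)
  with f assms(2) show ?case
    by (intro Ck_on_SucI[OF assms(1) has_partials_inverse[OF Ck_on_Suc_has_partials[OF Suc.prems]]]
        mult)
qed

section \<open>Smooth functions\<close>

lemma smooth_on_cong:
  "smooth_on U f \<Longrightarrow> open U \<Longrightarrow> (\<And>p. p \<in> U \<Longrightarrow> f p = g p) \<Longrightarrow> smooth_on U g"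
  unfolding smooth_on_def by (blast intro: Ck_on_cong)

lemma smooth_on_subset: "smooth_on U f \<Longrightarrow> V \<subseteq> U \<Longrightarrow> smooth_on V f"
  by (auto simp: smooth_on_def intro: Ck_on_subset)

lemma smooth_on_has_partials:
  "smooth_on U f \<Longrightarrow> p \<in> U \<Longrightarrow> has_partials f (pdx f p) (pdy f p) p"
  by (meson Ck_on_Suc_has_partials smooth_on_def)

text \<open>Gains one order of regularity: \<open>Ck_on (Suc k)\<close> holds for every
  \<open>k\<close>, and lowering the order covers the remaining case 0. It makes potentials of
  smooth forms smooth.\<close>

lemma smooth_onI:
  assumes "open U" "\<And>p. p \<in> U \<Longrightarrow> has_partials f (a p) (b p) p" "smooth_on U a" "smooth_on U b"
  shows "smooth_on U f"
  using Ck_on_SucI[OF assms(1,2)] assms(3,4) Ck_on_SucD unfolding smooth_on_def by blast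

lemma smooth_on_pdx: "smooth_on U f \<Longrightarrow> smooth_on U (pdx f)"
  and smooth_on_pdy: "smooth_on U f \<Longrightarrow> smooth_on U (pdy f)"
  by (meson Ck_on.simps(2) smooth_on_def)+

context
  fixes U :: "(real \<times> real) set"
  assumes U: "open U"
begin

lemma smooth_on_const: "smooth_on U (\<lambda>p. c)"
  by (simp add: smooth_on_def Ck_on_const U)

lemma smooth_on_add: "smooth_on U f \<Longrightarrow> smooth_on U g \<Longrightarrow> smooth_on U (\<lambda>p. f p + g p)"
  by (simp add: smooth_on_def Ck_on_add U)

lemma smooth_on_bilinear:
  "bounded_bilinear mul \<Longrightarrow> smooth_on U f \<Longrightarrow> smooth_on U g \<Longrightarrow> smooth_on U (\<lambda>p. mul (f p) (g p))"
  by (simp add: smooth_on_def Ck_on_bilinear U)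

lemmas smooth_on_mult = smooth_on_bilinear[OF bounded_bilinear_mult]
lemmas smooth_on_scaleR = smooth_on_bilinear[OF bounded_bilinear_scaleR]

lemma smooth_on_minus: "smooth_on U f \<Longrightarrow> smooth_on U (\<lambda>p. - f p)"
  using smooth_on_scaleR[OF smooth_on_const[of "-1"]] by fastforce

lemma smooth_on_diff: "smooth_on U f \<Longrightarrow> smooth_on U g \<Longrightarrow> smooth_on U (\<lambda>p. f p - g p)"
  using smooth_on_add[OF _ smooth_on_minus] by fastforce

lemma smooth_on_sin: "smooth_on U f \<Longrightarrow> smooth_on U (\<lambda>p. sin (f p) :: real)"
  and smooth_on_cos: "smooth_on U f \<Longrightarrow> smooth_on U (\<lambda>p. cos (f p) :: real)"
  by (simp_all add: smooth_on_def Ck_on_sin_cos U)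

lemma smooth_on_inverse:
  fixes f :: "real \<times> real \<Rightarrow> real"
  shows "smooth_on U f \<Longrightarrow> (\<And>p. p \<in> U \<Longrightarrow> f p \<noteq> 0) \<Longrightarrow> smooth_on U (\<lambda>p. inverse (f p))"
  by (simp add: smooth_on_def Ck_on_inverse U)

end

text \<open>The device for differentiating an identity that holds on an open set: each side is
  differentiated by its own rule and the results are compared. The structure equations of the
  surface are obtained in this way.\<close>

lemma has_partials_unique:
  assumes "has_partials f a b p" "has_partials g c d p" "open U" "p \<in> U" "\<And>q. q \<in> U \<Longrightarrow> f q = g q"
  shows "a = c" "b = d"
  using has_partials_imp_pdx[OF assms(2)] has_partials_imp_pdy[OF assms(2)]
    has_partials_imp_pdx[OF has_partials_cong[OF assms(1,3,4,5)]]
    has_partials_imp_pdy[OF has_partials_cong[OF assms(1,3,4,5)]] by auto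

lemma has_partials_divide:
  fixes f g :: "real \<times> real \<Rightarrow> real"
  assumes "has_partials f a b p" "has_partials g c d p" "g p \<noteq> 0"
  shows "has_partials (\<lambda>p. f p / g p) ((a * g p - f p * c) / (g p)\<^sup>2) ((b * g p - f p * d) / (g p)\<^sup>2) p"
proof -
  have *: "(x * g p - f p * y) / (g p)\<^sup>2 = x * inverse (g p) + f p * (- (inverse (g p))\<^sup>2 * y)" for x y
    using assms(3) by (simp add: field_simps power2_eq_square)
  show ?thesis
    unfolding divide_inverse[of "f _"] *
    by (intro has_partials_mult has_partials_inverse assms)
qed

lemma smooth_on_divide:
  fixes f g :: "real \<times> real \<Rightarrow> real"
  assumes "open U" "smooth_on U f" "smooth_on U g" "\<And>p. p \<in> U \<Longrightarrow> g p \<noteq> 0"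
  shows "smooth_on U (\<lambda>p. f p / g p)"
  unfolding divide_inverse using assms by (intro smooth_on_mult smooth_on_inverse)

section \<open>Symmetry of mixed partial derivatives\<close>

text \<open>The mean value theorem is applied twice: in the first variable to the difference of
  \<open>f\<close> along the two horizontal edges of the square, then in the second variable to
  \<open>pdx f\<close>.\<close>

lemma second_difference_mvt:
  fixes f :: "real \<times> real \<Rightarrow> real"
  assumes "h > 0"
    and f: "\<And>x y. \<lbrakk>a \<le> x; x \<le> a + h; b \<le> y; y \<le> b + h\<rbrakk> \<Longrightarrow> f differentiable (at (x, y))"
    and f': "\<And>x y. \<lbrakk>a \<le> x; x \<le> a + h; b \<le> y; y \<le> b + h\<rbrakk> \<Longrightarrow> pdx f differentiable (at (x, y))"
  obtains x y where "a < x" "x < a + h" "b < y" "y < b + h"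
    "f (a + h, b + h) - f (a + h, b) - f (a, b + h) + f (a, b) = h * h * pdy (pdx f) (x, y)"
proof -
  have 1: "((\<lambda>t. f (t, b + h) - f (t, b)) has_real_derivative pdx f (x, b + h) - pdx f (x, b)) (at x)"
    if "a \<le> x" "x \<le> a + h" for x
  proof -
    have "((\<lambda>t. f (t, y)) has_real_derivative pdx f (x, y)) (at x)" if "b \<le> y" "y \<le> b + h" for y
      using has_partials_slice_x[OF f[OF \<open>a \<le> x\<close> \<open>x \<le> a + h\<close> that, unfolded differentiable_iff_has_partials]]
      by (simp add: has_real_derivative_iff_has_vector_derivative)
    then show ?thesis using \<open>h > 0\<close> by (auto intro!: derivative_intros)
  qed
  from MVT2[OF _ 1, of a "a + h"] \<open>h > 0\<close> obtain x where x: "a < x" "x < a + h" and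
    eq1: "f (a + h, b + h) - f (a + h, b) - (f (a, b + h) - f (a, b)) =
      h * (pdx f (x, b + h) - pdx f (x, b))" by auto
  have 2: "((\<lambda>t. pdx f (x, t)) has_real_derivative pdy (pdx f) (x, y)) (at y)"
    if "b \<le> y" "y \<le> b + h" for y
    using has_partials_slice_y[OF f'[of x y, unfolded differentiable_iff_has_partials]] that x
    by (simp add: has_real_derivative_iff_has_vector_derivative)
  from MVT2[OF _ 2, of b "b + h"] \<open>h > 0\<close> obtain y where y: "b < y" "y < b + h" and
    eq2: "pdx f (x, b + h) - pdx f (x, b) = h * pdy (pdx f) (x, y)" by auto
  show thesis using that[OF x y] eq1 eq2 by simp
qed

text \<open>Exchanging the coordinates turns a result on one order of differentiation into the
  result on the other.\<close>

lemma pdx_swap: "pdx (\<lambda>q. f (prod.swap q)) = (\<lambda>q. pdy f (prod.swap q))"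
  and pdy_swap: "pdy (\<lambda>q. f (prod.swap q)) = (\<lambda>q. pdx f (prod.swap q))"
  by (auto simp: pdx_def pdy_def fun_eq_iff)

lemma differentiable_swap:
  fixes f :: "real \<times> real \<Rightarrow> 'a::real_normed_vector"
  shows "f differentiable (at (y, x)) \<Longrightarrow> (\<lambda>q. f (prod.swap q)) differentiable (at (x, y))"
proof (rule differentiable_compose[of f prod.swap])
  have "prod.swap = (\<lambda>q::real \<times> real. (snd q, fst q))"
    by auto
  moreover have "(\<lambda>q::real \<times> real. (snd q, fst q)) differentiable (at (x, y))"
    by (rule differentiableI[OF bounded_linear_imp_has_derivative[OF
          bounded_linear_Pair[OF bounded_linear_snd bounded_linear_fst]]])
  ultimately show "(prod.swap :: real \<times> real \<Rightarrow> _) differentiable (at (x, y))"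
    by simp
qed simp

lemma Ck_on_2D:
  assumes "Ck_on 2 U f"
  shows "\<And>p. p \<in> U \<Longrightarrow> f differentiable (at p)" "\<And>p. p \<in> U \<Longrightarrow> pdx f differentiable (at p)"
    "\<And>p. p \<in> U \<Longrightarrow> pdy f differentiable (at p)" "continuous_on U (pdy (pdx f))" "continuous_on U (pdx (pdy f))"
  using assms by (auto simp: numeral_2_eq_2)

text \<open>The second difference over a square of side \<open>h\<close> is \<open>h * h\<close>
  times either mixed derivative, each taken at some point of the square. If the two differed at
  \<open>p\<close>, continuity would keep them apart on a small square.\<close>

lemma mixed_partials_real:
  fixes f :: "real \<times> real \<Rightarrow> real"
  assumes U: "open U" "p \<in> U" and f: "Ck_on 2 U f"
  shows "pdy (pdx f) p = pdx (pdy f) p"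
proof (rule ccontr)
  assume "pdy (pdx f) p \<noteq> pdx (pdy f) p"
  \<comment> \<open>Half the gap: two numbers, each closer than \<open>e\<close> to one of the two
    values at \<open>p\<close>, cannot coincide.\<close>
  define e where "e = \<bar>pdy (pdx f) p - pdx (pdy f) p\<bar> / 2"
  have "e > 0" using \<open>_ \<noteq> _\<close> by (simp add: e_def)
  note D = Ck_on_2D[OF f]
  obtain a b where p: "p = (a, b)" by (cases p)
  obtain d0 where d0: "d0 > 0" "ball p d0 \<subseteq> U"
    using U openE by blast
  obtain d1 where d1: "d1 > 0" "\<And>q. q \<in> U \<Longrightarrow> dist q p < d1 \<Longrightarrow> \<bar>pdy (pdx f) q - pdy (pdx f) p\<bar> < e"
    using D(4) U(2) \<open>e > 0\<close> unfolding continuous_on_iff dist_real_def by metis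
  obtain d2 where d2: "d2 > 0" "\<And>q. q \<in> U \<Longrightarrow> dist q p < d2 \<Longrightarrow> \<bar>pdx (pdy f) q - pdx (pdy f) p\<bar> < e"
    using D(5) U(2) \<open>e > 0\<close> unfolding continuous_on_iff dist_real_def by metis
  \<comment> \<open>Points of the square have distance at most \<open>2 * h\<close> from its corner
    \<open>p\<close>; the factor 3 makes all three bounds strict.\<close>
  define h where "h = min d0 (min d1 d2) / 3"
  have "h > 0" using d0 d1 d2 by (simp add: h_def)
  have h: "3 * h \<le> d0" "3 * h \<le> d1" "3 * h \<le> d2" by (auto simp: h_def)
  have near: "dist (x, y) p < 3 * h" if "a \<le> x" "x \<le> a + h" "b \<le> y" "y \<le> b + h" for x y
  proof -
    have "dist (x, y) p \<le> \<bar>x - a\<bar> + \<bar>y - b\<bar>"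
      by (simp add: p dist_prod_def dist_real_def sqrt_sum_squares_le_sum_abs)
    then show ?thesis using that \<open>h > 0\<close> by linarith
  qed
  have inU: "(x, y) \<in> U" if "a \<le> x" "x \<le> a + h" "b \<le> y" "y \<le> b + h" for x y
  proof -
    have "dist p (x, y) < d0" using near[OF that] h by (simp add: dist_commute)
    then show ?thesis using d0 by auto
  qed
  obtain x y where xy: "a < x" "x < a + h" "b < y" "y < b + h" and
    1: "f (a + h, b + h) - f (a + h, b) - f (a, b + h) + f (a, b) = h * h * pdy (pdx f) (x, y)"
    by (rule second_difference_mvt[of h a b f, OF \<open>h > 0\<close> D(1)[OF inU] D(2)[OF inU]])
  \<comment> \<open>The second difference is symmetric in the coordinates, so the swapped function
    yields the other mixed derivative.\<close>
  obtain y' x' where xy': "b < y'" "y' < b + h" "a < x'" "x' < a + h" and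
    2: "f (a + h, b + h) - f (a, b + h) - f (a + h, b) + f (a, b) = h * h * pdx (pdy f) (x', y')"
  proof (rule second_difference_mvt[of h b a "\<lambda>q. f (prod.swap q)"])
    show "(\<lambda>q. f (prod.swap q)) differentiable (at (x, y))"
      and "pdx (\<lambda>q. f (prod.swap q)) differentiable (at (x, y))"
      if "b \<le> x" "x \<le> b + h" "a \<le> y" "y \<le> a + h" for x y
      using that D(1,3) inU by (auto intro!: differentiable_swap simp: pdx_swap)
  qed (use \<open>h > 0\<close> in \<open>auto simp: pdx_swap pdy_swap\<close>)
  have "h * h * pdy (pdx f) (x, y) = h * h * pdx (pdy f) (x', y')"
    using 1 2 by linarith
  then have "pdy (pdx f) (x, y) = pdx (pdy f) (x', y')"
    using \<open>h > 0\<close> by simp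
  moreover have "\<bar>pdy (pdx f) (x, y) - pdy (pdx f) p\<bar> < e"
    using xy near[of x y] h by (intro d1 inU) auto
  moreover have "\<bar>pdx (pdy f) (x', y') - pdx (pdy f) p\<bar> < e"
    using xy' near[of x' y'] h by (intro d2 inU) auto
  ultimately show False unfolding e_def by argo
qed

text \<open>Taking inner products with basis vectors reduces the claim to real-valued
  functions.\<close>

lemma mixed_partials:
  fixes f :: "real \<times> real \<Rightarrow> 'a::euclidean_space"
  assumes U: "open U" "p \<in> U" and f: "Ck_on 2 U f"
  shows "pdy (pdx f) p = pdx (pdy f) p"
proof (rule euclidean_eqI)
  fix i :: 'a assume "i \<in> Basis"
  note D = Ck_on_2D[OF f, unfolded differentiable_iff_has_partials]
  have inner: "has_partials (\<lambda>q. g q \<bullet> i) (pdx g q \<bullet> i) (pdy g q \<bullet> i) q"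
    if "has_partials g (pdx g q) (pdy g q) q" for g :: "real \<times> real \<Rightarrow> 'a" and q
    using has_partials_inner[OF that has_partials_const[of i]] by simp
  have 1: "has_partials (\<lambda>q. f q \<bullet> i) (pdx f q \<bullet> i) (pdy f q \<bullet> i) q" if "q \<in> U" for q
    using inner D(1) that by blast
  have x: "has_partials (pdx (\<lambda>q. f q \<bullet> i)) (pdx (pdx f) p \<bullet> i) (pdy (pdx f) p \<bullet> i) p"
    using has_partials_imp_pdx[OF 1]
    by (intro has_partials_cong[OF inner[OF D(2)[OF U(2)]] U]) simp
  have y: "has_partials (pdy (\<lambda>q. f q \<bullet> i)) (pdx (pdy f) p \<bullet> i) (pdy (pdy f) p \<bullet> i) p"
    using has_partials_imp_pdy[OF 1]
    by (intro has_partials_cong[OF inner[OF D(3)[OF U(2)]] U]) simp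
  have "Ck_on 2 U (\<lambda>q. f q \<bullet> i)"
    using Ck_on_bilinear[OF bounded_bilinear_inner U(1) f Ck_on_const[OF U(1)]] .
  from mixed_partials_real[OF U this] show "pdy (pdx f) p \<bullet> i = pdx (pdy f) p \<bullet> i"
    using has_partials_imp_pdy[OF x] has_partials_imp_pdx[OF y] by simp
qed

section \<open>Potentials of closed forms\<close>

text \<open>The potential is the integral of the form along the segment from a base point.\<close>

lemma closed_form_has_potential:
  fixes A B :: "real \<times> real \<Rightarrow> 'a::banach"
  assumes V: "open V" "convex V" and A: "Ck_on 1 V A" and B: "Ck_on 1 V B"
    and closed: "\<And>p. p \<in> V \<Longrightarrow> pdy A p = pdx B p"
  obtains f where "\<And>p. p \<in> V \<Longrightarrow> has_partials f (A p) (B p) p"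
proof (cases "V = {}")
  case False
  then obtain x0 y0 where p0: "(x0, y0) \<in> V" by auto
  \<comment> \<open>The segment from the base point to the given point; convexity keeps it inside
    \<open>V\<close>.\<close>
  define \<gamma> where "\<gamma> = (\<lambda>(x, y) t. (x0 + t * (x - x0), y0 + t * (y - y0)))"
  have \<gamma>: "\<gamma> p t \<in> V" if "p \<in> V" "t \<in> {0..1}" for p t
  proof -
    have "\<gamma> p t = (1 - t) *\<^sub>R (x0, y0) + t *\<^sub>R p"
      by (simp add: \<gamma>_def split_beta prod_eq_iff algebra_simps)
    then show ?thesis using convexD[OF V(2) p0 that(1), of "1 - t" t] that(2) by simp
  qed
  have A': "has_partials A (pdx A p) (pdy A p) p" and B': "has_partials B (pdx B p) (pdy B p) p"
    if "p \<in> V" for p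
    using A B that by (auto simp: differentiable_iff_has_partials)
  have cont: "continuous_on V A" "continuous_on V B" "continuous_on V (pdx A)" "continuous_on V (pdy A)"
      "continuous_on V (pdx B)" "continuous_on V (pdy B)"
    using A B Ck_on_SucD[of 0 V A] Ck_on_SucD[of 0 V B] by auto
  have cont_\<gamma>: "continuous_on S (\<lambda>q. \<gamma> (fst q) (snd q))" for S
    by (auto simp: \<gamma>_def split_beta intro!: continuous_intros)
  \<comment> \<open>\<open>g p\<close> is the integrand of the line integral, and
    \<open>a p\<close>, \<open>b p\<close> are its partial derivatives with respect to the
    coordinates of \<open>p\<close>, already simplified by closedness.\<close>
  define g where "g = (\<lambda>p t. (fst p - x0) *\<^sub>R A (\<gamma> p t) + (snd p - y0) *\<^sub>R B (\<gamma> p t))"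
  define a where "a = (\<lambda>p t. A (\<gamma> p t) + t *\<^sub>R
    ((fst p - x0) *\<^sub>R pdx A (\<gamma> p t) + (snd p - y0) *\<^sub>R pdy A (\<gamma> p t)))"
  define b where "b = (\<lambda>p t. B (\<gamma> p t) + t *\<^sub>R
    ((fst p - x0) *\<^sub>R pdx B (\<gamma> p t) + (snd p - y0) *\<^sub>R pdy B (\<gamma> p t)))"
  \<comment> \<open>The derivative of the integrand as a bounded linear function, the form in which
    \<open>leibniz_rule\<close> expects it.\<close>
  define G where "G = (\<lambda>p t. (blinfun_scaleR_left (a p t) o\<^sub>L fst_blinfun) +
    (blinfun_scaleR_left (b p t) o\<^sub>L snd_blinfun))"
  have G_apply: "blinfun_apply (G p t) h = fst h *\<^sub>R a p t + snd h *\<^sub>R b p t" for p t h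
    by (simp add: G_def blinfun.add_left)
  note cont2 = cont[THEN continuous_on_compose2, OF cont_\<gamma>]
  have img: "(\<lambda>q. \<gamma> (fst q) (snd q)) ` (V \<times> {0..1}) \<subseteq> V" using \<gamma> by auto
  have cont_ab: "continuous_on (V \<times> {0..1}) (\<lambda>q. a (fst q) (snd q))"
    "continuous_on (V \<times> {0..1}) (\<lambda>q. b (fst q) (snd q))"
    "continuous_on (V \<times> {0..1}) (\<lambda>q. g (fst q) (snd q))"
    unfolding a_def b_def g_def by (intro continuous_intros cont2 img)+
  have cont_t: "continuous_on {0..1} (\<lambda>t. F p t)"
    if "continuous_on (V \<times> {0..1}) (\<lambda>q. F (fst q) (snd q))" "p \<in> V" for p and F :: "real \<times> real \<Rightarrow> real \<Rightarrow> 'b::topological_space"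
  proof -
    have "continuous_on {0..1} (\<lambda>t. (p, t))"
      by (intro continuous_intros)
    from continuous_on_compose2[OF that(1) this] that(2) show ?thesis by auto
  qed
  have contG: "continuous_on (V \<times> {0..1}) (\<lambda>q. G (fst q) (snd q))"
    unfolding G_def
    by (intro continuous_intros cont_ab
        bounded_bilinear.continuous_on[OF bounded_bilinear_blinfun_compose]
        bounded_linear.continuous_on[OF bounded_linear_blinfun_scaleR_left])
  have deriv: "((\<lambda>p. g p t) has_derivative blinfun_apply (G p t)) (at p)"
    if "p \<in> V" "t \<in> {0..1}" for p t
  proof -
    have d\<gamma>: "((\<lambda>p. \<gamma> p t) has_derivative (\<lambda>h. t *\<^sub>R h)) (at p)"
      by (auto simp: \<gamma>_def split_beta prod_eq_iff intro!: derivative_eq_intros)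
    have "(A has_derivative (\<lambda>h. fst h *\<^sub>R pdx A (\<gamma> p t) + snd h *\<^sub>R pdy A (\<gamma> p t))) (at (\<gamma> p t))"
      using A'[OF \<gamma>[OF that]] by (simp add: has_partials_def)
    from has_derivative_compose[OF d\<gamma> this]
    have 1: "((\<lambda>p. A (\<gamma> p t)) has_derivative
      (\<lambda>h. t *\<^sub>R (fst h *\<^sub>R pdx A (\<gamma> p t) + snd h *\<^sub>R pdy A (\<gamma> p t)))) (at p)"
      by (simp add: scaleR_add_right)
    have "(B has_derivative (\<lambda>h. fst h *\<^sub>R pdx B (\<gamma> p t) + snd h *\<^sub>R pdy B (\<gamma> p t))) (at (\<gamma> p t))"
      using B'[OF \<gamma>[OF that]] by (simp add: has_partials_def)
    from has_derivative_compose[OF d\<gamma> this]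
    have 2: "((\<lambda>p. B (\<gamma> p t)) has_derivative
      (\<lambda>h. t *\<^sub>R (fst h *\<^sub>R pdx B (\<gamma> p t) + snd h *\<^sub>R pdy B (\<gamma> p t)))) (at p)"
      by (simp add: scaleR_add_right)
    have "((\<lambda>p. g p t) has_derivative (\<lambda>h.
       (fst p - x0) *\<^sub>R (t *\<^sub>R (fst h *\<^sub>R pdx A (\<gamma> p t) + snd h *\<^sub>R pdy A (\<gamma> p t))) + fst h *\<^sub>R A (\<gamma> p t) +
       ((snd p - y0) *\<^sub>R (t *\<^sub>R (fst h *\<^sub>R pdx B (\<gamma> p t) + snd h *\<^sub>R pdy B (\<gamma> p t))) + snd h *\<^sub>R B (\<gamma> p t)))) (at p)"
      unfolding g_def
      by (rule derivative_eq_intros 1 2 refl)+ (simp add: fun_eq_iff)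
    \<comment> \<open>Closedness exchanges \<open>pdx B\<close> and \<open>pdy A\<close>, which
      turns the raw product-rule derivative into \<open>a\<close> and \<open>b\<close>.\<close>
    then show ?thesis
      using closed[OF \<gamma>[OF that]]
      by (rule_tac has_derivative_eq_rhs) (auto simp: fun_eq_iff G_apply a_def b_def algebra_simps)
  qed
  \<comment> \<open>\<open>a p\<close> is the derivative of
    \<open>t *\<^sub>R A (\<gamma> p t)\<close> in \<open>t\<close>. Its integral is the difference
    of the end values: \<open>A p\<close> at \<open>t = 1\<close> and zero at \<open>t = 0\<close>.
    The same holds for \<open>b\<close> and \<open>B\<close>.\<close>
  have int_a: "integral {0..1} (a p) = A p" and int_b: "integral {0..1} (b p) = B p"
    if "p \<in> V" for p
  proof -
    have *: "integral {0..1} (\<lambda>t. C (\<gamma> p t) + t *\<^sub>R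
        ((fst p - x0) *\<^sub>R pdx C (\<gamma> p t) + (snd p - y0) *\<^sub>R pdy C (\<gamma> p t))) = C p"
      if C: "\<And>q. q \<in> V \<Longrightarrow> has_partials C (pdx C q) (pdy C q) q" for C :: "real \<times> real \<Rightarrow> 'a"
    proof -
      have "((\<lambda>t. t *\<^sub>R C (\<gamma> p t)) has_vector_derivative (C (\<gamma> p t) + t *\<^sub>R
        ((fst p - x0) *\<^sub>R pdx C (\<gamma> p t) + (snd p - y0) *\<^sub>R pdy C (\<gamma> p t)))) (at t within {0..1})"
        if "t \<in> {0..1}" for t
      proof -
        have d\<gamma>: "(\<gamma> p has_derivative (\<lambda>h. (h * (fst p - x0), h * (snd p - y0)))) (at t within {0..1})"
          by (auto simp: \<gamma>_def split_beta prod_eq_iff intro!: derivative_eq_intros)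
        have "(C has_derivative (\<lambda>h. fst h *\<^sub>R pdx C (\<gamma> p t) + snd h *\<^sub>R pdy C (\<gamma> p t))) (at (\<gamma> p t))"
          using C[OF \<gamma>[OF \<open>p \<in> V\<close> that]] by (simp add: has_partials_def)
        note 1 = has_derivative_compose[OF d\<gamma> this]
        show ?thesis unfolding has_vector_derivative_def
          by (rule derivative_eq_intros 1 refl)+ (simp add: fun_eq_iff algebra_simps)
      qed
      from fundamental_theorem_of_calculus[OF _ this]
      show ?thesis
        by (simp add: integral_unique \<gamma>_def split_beta)
    qed
    show "integral {0..1} (a p) = A p" unfolding a_def by (rule *[OF A'])
    show "integral {0..1} (b p) = B p" unfolding b_def by (rule *[OF B'])
  qed
  show thesis
  proof
    fix p assume p: "p \<in> V"
    have L: "((\<lambda>p. integral (cbox 0 1) (g p)) has_derivative blinfun_apply (integral (cbox 0 1) (G p))) (at p within V)"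
    proof (rule leibniz_rule)
      show "((\<lambda>x. g x t) has_derivative blinfun_apply (G q t)) (at q within V)"
        if "q \<in> V" "t \<in> cbox 0 1" for q t
        using deriv[of q t] that by (auto intro: has_derivative_at_withinI)
      show "g q integrable_on cbox 0 1" if "q \<in> V" for q
        using cont_t[OF cont_ab(3) that] by (auto intro: integrable_continuous_interval)
      show "continuous_on (V \<times> cbox 0 1) (\<lambda>(x, t). G x t)"
        using contG by (simp add: split_beta)
    qed (use p V in auto)
    have "blinfun_apply (integral {0..1} (G p)) h = fst h *\<^sub>R A p + snd h *\<^sub>R B p" for h
    proof -
      have "(G p has_integral integral {0..1} (G p)) {0..1}"
        "(a p has_integral A p) {0..1}" "(b p has_integral B p) {0..1}"
        using cont_t[OF contG p] cont_t[OF cont_ab(1) p] cont_t[OF cont_ab(2) p]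
        unfolding int_a[OF p, symmetric] int_b[OF p, symmetric]
        by (auto intro: integrable_continuous_interval integrable_integral)
      note G = this(1) and ab = this(2,3)
      have "((\<lambda>t. blinfun_apply (G p t) h) has_integral blinfun_apply (integral {0..1} (G p)) h) {0..1}"
        using has_integral_linear[OF G blinfun.bounded_linear_left[of h]] by (simp add: o_def)
      moreover have "((\<lambda>t. blinfun_apply (G p t) h) has_integral fst h *\<^sub>R A p + snd h *\<^sub>R B p) {0..1}"
        unfolding G_apply by (intro has_integral_add has_integral_cmul ab)
      ultimately show ?thesis by (rule has_integral_unique)
    qed
    then have "((\<lambda>p. integral {0..1} (g p)) has_derivative (\<lambda>h. fst h *\<^sub>R A p + snd h *\<^sub>R B p)) (at p within V)"
      by (intro has_derivative_eq_rhs[OF L[unfolded cbox_interval]] ext)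
    then show "has_partials (\<lambda>p. integral {0..1} (g p)) (A p) (B p) p"
      unfolding has_partials_def at_within_open[OF p V(1)] .
  qed
qed (use that[of "\<lambda>_. 0"] in auto)

lemma smooth_on_mixed_partials:
  fixes f :: "real \<times> real \<Rightarrow> 'a::euclidean_space"
  shows "open U \<Longrightarrow> smooth_on U f \<Longrightarrow> p \<in> U \<Longrightarrow> pdy (pdx f) p = pdx (pdy f) p"
  by (rule mixed_partials) (auto simp: smooth_on_def)

section \<open>Pseudospherical surfaces and Voss nets\<close>

lemma quad_form_eq_iff:
  "quad_form E F G = quad_form E' F' G' \<longleftrightarrow> E = E' \<and> F = F' \<and> G = G'"
  by (auto simp: quad_form_def vec_eq_iff forall_2)

lemma first_form_eq_quad_form:
  "first_form f p = quad_form (pdx f p \<bullet> pdx f p) (pdx f p \<bullet> pdy f p) (pdy f p \<bullet> pdy f p)"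
  by (simp add: first_form_def quad_form_def inner_commute)

lemma det_quad_form: "det (quad_form E F G) = E * G - F\<^sup>2"
  by (simp add: quad_form_def det_2 power2_eq_square)

text \<open>By the Lagrange identity, a vector orthogonal to \<open>a\<close> and \<open>b\<close>
  is a multiple of their cross product. Both \<open>n\<close> and \<open>v\<close> are such
  multiples, and \<open>n\<close> is not zero.\<close>

lemma eq_zero_if_orthogonal:
  fixes a b n v :: "real^3"
  assumes "cross3 a b \<noteq> 0" "n \<noteq> 0" "n \<bullet> a = 0" "n \<bullet> b = 0" "v \<bullet> a = 0" "v \<bullet> b = 0" "v \<bullet> n = 0"
  shows "v = 0"
proof -
  have multiple: "\<exists>k. u = k *\<^sub>R cross3 a b" if "u \<bullet> a = 0" "u \<bullet> b = 0" for u
  proof -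
    have "cross3 (cross3 a b) u = 0"
      unfolding cross_skew[of "cross3 a b"] Lagrange using that by simp
    then show ?thesis
      using assms(1) by (auto simp: cross_eq_0 collinear_lemma)
  qed
  from multiple[OF assms(3,4)] multiple[OF assms(5,6)] obtain k l
    where "n = k *\<^sub>R cross3 a b" "v = l *\<^sub>R cross3 a b" by blast
  with assms(1,2,7) show ?thesis by auto
qed

section \<open>The moving frame and its structure equations\<close>

locale pseudospherical_surface =
  fixes U :: "(real \<times> real) set" and \<phi> :: "real \<times> real \<Rightarrow> real" and r n :: "real \<times> real \<Rightarrow> real^3"
  assumes open_U: "open U" and pseudospherical: "pseudospherical U \<phi> r n"
begin

lemma smooth: "smooth_on U \<phi>" "smooth_on U r" "smooth_on U n"
  using pseudospherical by (auto simp: pseudospherical_def nonsingular_net_def unit_normal_def)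

lemma metric:
  assumes "p \<in> U"
  shows "pdx r p \<bullet> pdx r p = 1" "pdx r p \<bullet> pdy r p = cos (\<phi> p)" "pdy r p \<bullet> pdx r p = cos (\<phi> p)"
    "pdy r p \<bullet> pdy r p = 1"
proof -
  have "first_form r p = quad_form 1 (cos (\<phi> p)) 1"
    using pseudospherical assms by (auto simp: pseudospherical_def)
  then show "pdx r p \<bullet> pdx r p = 1" "pdx r p \<bullet> pdy r p = cos (\<phi> p)" "pdy r p \<bullet> pdx r p = cos (\<phi> p)"
    "pdy r p \<bullet> pdy r p = 1"
    by (auto simp: first_form_eq_quad_form quad_form_eq_iff inner_commute)
qed

lemma normal:
  assumes "p \<in> U"
  shows "n p \<bullet> n p = 1" "n p \<bullet> pdx r p = 0" "n p \<bullet> pdy r p = 0" "pdx r p \<bullet> n p = 0" "pdy r p \<bullet> n p = 0"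
  using pseudospherical assms
  by (auto simp: pseudospherical_def unit_normal_def inner_commute norm_eq_1)

lemma second_fundamental:
  assumes "p \<in> U"
  shows "pdx (pdx r) p \<bullet> n p = 0" "pdy (pdx r) p \<bullet> n p = sin (\<phi> p)"
    "pdx (pdy r) p \<bullet> n p = sin (\<phi> p)" "pdy (pdy r) p \<bullet> n p = 0"
proof -
  have "second_form r n p = quad_form 0 (sin (\<phi> p)) 0"
    using pseudospherical assms by (auto simp: pseudospherical_def)
  then show "pdx (pdx r) p \<bullet> n p = 0" "pdy (pdx r) p \<bullet> n p = sin (\<phi> p)"
    "pdx (pdy r) p \<bullet> n p = sin (\<phi> p)" "pdy (pdy r) p \<bullet> n p = 0"
    by (auto simp: second_form_def quad_form_def vec_eq_iff forall_2)
qed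

text \<open>The determinant of the first form is \<open>1 - cos\<^sup>2 \<phi>\<close>, that is,
  \<open>sin\<^sup>2 \<phi>\<close>.\<close>

lemma sin_nonzero: "p \<in> U \<Longrightarrow> sin (\<phi> p) \<noteq> 0"
proof -
  assume p: "p \<in> U"
  then have "det (first_form r p) \<noteq> 0"
    using pseudospherical by (auto simp: pseudospherical_def nonsingular_net_def)
  then have "1 - (cos (\<phi> p))\<^sup>2 \<noteq> 0"
    using metric[OF p] by (simp add: first_form_eq_quad_form det_quad_form)
  then show ?thesis by (simp add: cos_squared_eq)
qed

text \<open>The squared length of the cross product of the tangent vectors is
  \<open>sin\<^sup>2 \<phi>\<close>, so tangents and normal form a frame, and inner products with it
  determine a vector.\<close>

lemma frame_eqI:
  assumes p: "p \<in> U" and "v \<bullet> pdx r p = w \<bullet> pdx r p" "v \<bullet> pdy r p = w \<bullet> pdy r p" "v \<bullet> n p = w \<bullet> n p"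
  shows "v = w"
proof -
  have "(norm (cross3 (pdx r p) (pdy r p)))\<^sup>2 = (sin (\<phi> p))\<^sup>2"
    using norm_cross_dot[of "pdx r p" "pdy r p"] metric[OF p]
    by (simp add: norm_eq_1[THEN iffD2] sin_squared_eq)
  then have "cross3 (pdx r p) (pdy r p) \<noteq> 0"
    using sin_nonzero[OF p] by auto
  moreover have "n p \<noteq> 0" using normal(1)[OF p] by auto
  ultimately show ?thesis
    using eq_zero_if_orthogonal[of "pdx r p" "pdy r p" "n p" "v - w"] normal[OF p] assms(2-4) by (auto simp: inner_diff_left)
qed

lemma partials_angle: "p \<in> U \<Longrightarrow> has_partials \<phi> (pdx \<phi> p) (pdy \<phi> p) p"
  by (rule smooth_on_has_partials[OF smooth(1)])

text \<open>Differentiating the constant coefficients 1 and the coefficient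
  \<open>cos \<phi>\<close> of the first form gives the tangential products of the second
  derivatives of \<open>r\<close>; the second form gives the normal ones. Differentiating
  \<open>n \<bullet> n = 1\<close> and the two orthogonality relations does the same for
  \<open>n\<close>. Then \<open>frame_eqI\<close> applies.\<close>

lemma gauss_weingarten:
  assumes p: "p \<in> U"
  shows "pdx (pdx r) p = (pdx \<phi> p * cot (\<phi> p)) *\<^sub>R pdx r p - (pdx \<phi> p / sin (\<phi> p)) *\<^sub>R pdy r p"
    "pdy (pdx r) p = sin (\<phi> p) *\<^sub>R n p"
    "pdx (pdy r) p = sin (\<phi> p) *\<^sub>R n p"
    "pdy (pdy r) p = (pdy \<phi> p * cot (\<phi> p)) *\<^sub>R pdy r p - (pdy \<phi> p / sin (\<phi> p)) *\<^sub>R pdx r p"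
    "pdx n p = cot (\<phi> p) *\<^sub>R pdx r p - (1 / sin (\<phi> p)) *\<^sub>R pdy r p"
    "pdy n p = cot (\<phi> p) *\<^sub>R pdy r p - (1 / sin (\<phi> p)) *\<^sub>R pdx r p"
proof -
  define s c where "s = sin (\<phi> p)" and "c = cos (\<phi> p)"
  have s: "s \<noteq> 0" using sin_nonzero[OF p] by (simp add: s_def)
  have c2: "c * c = 1 - s * s"
    using sin_cos_squared_add2[of "\<phi> p"] by (simp add: s_def c_def power2_eq_square algebra_simps)
  have cot: "cot (\<phi> p) = c / s" by (simp add: cot_def s_def c_def)
  note rx = smooth_on_has_partials[OF smooth_on_pdx[OF smooth(2)] p]
  note ry = smooth_on_has_partials[OF smooth_on_pdy[OF smooth(2)] p]
  note nn = smooth_on_has_partials[OF smooth(3) p]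
  note unique = has_partials_unique[OF _ _ open_U p]
  note mixed = smooth_on_mixed_partials[OF open_U smooth(2) p]
  note sf = second_fundamental[OF p]
  note E = unique[OF has_partials_inner[OF rx rx] has_partials_const metric(1)]
  note F = unique[OF has_partials_inner[OF rx ry] has_partials_cos[OF partials_angle[OF p]] metric(2)]
  note G = unique[OF has_partials_inner[OF ry ry] has_partials_const metric(4)]
  have rxx: "pdx (pdx r) p \<bullet> pdx r p = 0" and rxy: "pdy (pdx r) p \<bullet> pdx r p = 0"
    and ryx: "pdy (pdx r) p \<bullet> pdy r p = 0" and ryy: "pdy (pdy r) p \<bullet> pdy r p = 0"
    using E G mixed by (auto simp: inner_commute)
  have rxx': "pdx (pdx r) p \<bullet> pdy r p = - s * pdx \<phi> p" and ryy': "pdy (pdy r) p \<bullet> pdx r p = - s * pdy \<phi> p"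
    using F rxy ryx mixed by (auto simp: inner_commute s_def)
  show 1: "pdy (pdx r) p = sin (\<phi> p) *\<^sub>R n p"
    using rxy ryx sf normal[OF p] by (intro frame_eqI[OF p]) auto
  then show "pdx (pdy r) p = sin (\<phi> p) *\<^sub>R n p" using mixed by simp
  note simps = inner_diff_left inner_scaleR_left metric[OF p] normal[OF p] cot c_def[symmetric] s_def[symmetric]
  \<comment> \<open>The scalar products of the claimed right-hand sides with the frame, reduced by
    \<open>c * c = 1 - s * s\<close>.\<close>
  have red: "k * (c / s) * c - k / s = - s * k" "c / s - (1 / s) * c = 0" "k * (c/s) - k / s * c = 0"
    "(c / s) * c - 1 / s = - s" for k
  proof -
    have "k * (c / s) * c - k / s = k * (c * c - 1) / s" using s by (simp add: field_simps)
    then show "k * (c / s) * c - k / s = - s * k" using s by (simp add: c2)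
    have "(c / s) * c - 1 / s = (c * c - 1) / s" using s by (simp add: field_simps)
    then show "(c / s) * c - 1 / s = - s" using s by (simp add: c2)
  qed (use s in simp_all)
  show "pdx (pdx r) p = (pdx \<phi> p * cot (\<phi> p)) *\<^sub>R pdx r p - (pdx \<phi> p / sin (\<phi> p)) *\<^sub>R pdy r p"
    using rxx rxx' sf red by (intro frame_eqI[OF p]) (simp_all add: simps)
  show "pdy (pdy r) p = (pdy \<phi> p * cot (\<phi> p)) *\<^sub>R pdy r p - (pdy \<phi> p / sin (\<phi> p)) *\<^sub>R pdx r p"
    using ryy ryy' sf red by (intro frame_eqI[OF p]) (simp_all add: simps)
  note N = unique[OF has_partials_inner[OF nn nn] has_partials_const normal(1)]
  note Nx = unique[OF has_partials_inner[OF nn rx] has_partials_const normal(2)]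
  note Ny = unique[OF has_partials_inner[OF nn ry] has_partials_const normal(3)]
  have "pdx n p \<bullet> n p = 0" "pdy n p \<bullet> n p = 0" "pdx n p \<bullet> pdx r p = 0" "pdx n p \<bullet> pdy r p = - s"
    "pdy n p \<bullet> pdx r p = - s" "pdy n p \<bullet> pdy r p = 0"
    using N Nx Ny sf by (auto simp: inner_commute s_def)
  then show "pdx n p = cot (\<phi> p) *\<^sub>R pdx r p - (1 / sin (\<phi> p)) *\<^sub>R pdy r p"
    "pdy n p = cot (\<phi> p) *\<^sub>R pdy r p - (1 / sin (\<phi> p)) *\<^sub>R pdx r p"
    using red by (auto intro!: frame_eqI[OF p] simp: simps)
qed

lemma partials_frame:
  assumes p: "p \<in> U"
  shows "has_partials (pdx r) ((pdx \<phi> p * cot (\<phi> p)) *\<^sub>R pdx r p - (pdx \<phi> p / sin (\<phi> p)) *\<^sub>R pdy r p)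
      (sin (\<phi> p) *\<^sub>R n p) p"
    "has_partials (pdy r) (sin (\<phi> p) *\<^sub>R n p)
      ((pdy \<phi> p * cot (\<phi> p)) *\<^sub>R pdy r p - (pdy \<phi> p / sin (\<phi> p)) *\<^sub>R pdx r p) p"
    "has_partials n (cot (\<phi> p) *\<^sub>R pdx r p - (1 / sin (\<phi> p)) *\<^sub>R pdy r p)
      (cot (\<phi> p) *\<^sub>R pdy r p - (1 / sin (\<phi> p)) *\<^sub>R pdx r p) p"
  using smooth_on_has_partials[OF smooth_on_pdx[OF smooth(2)] p]
    smooth_on_has_partials[OF smooth_on_pdy[OF smooth(2)] p] smooth_on_has_partials[OF smooth(3) p]
  unfolding gauss_weingarten[OF p] by auto

text \<open>The product of \<open>r\<^sub>x\<^sub>x\<^sub>y\<close> with \<open>r\<^sub>y\<close> is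
  found in two ways: from \<open>r\<^sub>x\<^sub>y = sin \<phi> n\<close>, and by differentiating
  \<open>r\<^sub>x\<^sub>x \<bullet> r\<^sub>y = - sin \<phi> \<phi>\<^sub>x\<close> in
  \<open>y\<close>. The terms with \<open>\<phi>\<^sub>x \<phi>\<^sub>y\<close> cancel, and a factor
  \<open>sin \<phi>\<close> can be divided out.\<close>

lemma sine_gordon:
  assumes p: "p \<in> U"
  shows "pdy (pdx \<phi>) p = sin (\<phi> p)"
proof -
  define s c where "s = sin (\<phi> p)" and "c = cos (\<phi> p)"
  have s: "s \<noteq> 0" using sin_nonzero[OF p] by (simp add: s_def)
  have c2: "c * c = 1 - s * s"
    using sin_cos_squared_add2[of "\<phi> p"] by (simp add: s_def c_def power2_eq_square algebra_simps)
  note sx = smooth_on_pdx[OF smooth(2)]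
  have "pdy (pdx (pdx r)) p = pdx (pdy (pdx r)) p"
    by (rule smooth_on_mixed_partials[OF open_U sx p])
  also have "\<dots> = (cos (\<phi> p) * pdx \<phi> p) *\<^sub>R n p + sin (\<phi> p) *\<^sub>R pdx n p"
    by (rule has_partials_unique(1)[OF smooth_on_has_partials[OF smooth_on_pdy[OF sx] p]
          has_partials_scaleR[OF has_partials_sin[OF partials_angle[OF p]] smooth_on_has_partials[OF smooth(3) p]]
          open_U p gauss_weingarten(2)])
  finally have rxxy: "pdy (pdx (pdx r)) p = \<dots>" .
  have F: "pdx (pdx r) q \<bullet> pdy r q = - sin (\<phi> q) * pdx \<phi> q" if "q \<in> U" for q
  proof -
    have "pdx (pdx r) q \<bullet> pdy r q = pdx \<phi> q * ((cos (\<phi> q))\<^sup>2 - 1) / sin (\<phi> q)"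
      using sin_nonzero[OF that]
      by (simp add: gauss_weingarten[OF that] inner_diff_left metric[OF that] cot_def
          field_simps power2_eq_square)
    then show ?thesis
      unfolding cos_squared_eq using sin_nonzero[OF that] by (simp add: power2_eq_square)
  qed
  have "pdy (pdx (pdx r)) p \<bullet> pdy r p + pdx (pdx r) p \<bullet> pdy (pdy r) p =
     - (cos (\<phi> p) * pdy \<phi> p) * pdx \<phi> p + - sin (\<phi> p) * pdy (pdx \<phi>) p"
    by (rule has_partials_unique(2)[OF has_partials_inner[OF smooth_on_has_partials[OF smooth_on_pdx[OF sx] p]
         smooth_on_has_partials[OF smooth_on_pdy[OF smooth(2)] p]]
         has_partials_mult[OF has_partials_minus[OF has_partials_sin[OF partials_angle[OF p]]]
           smooth_on_has_partials[OF smooth_on_pdx[OF smooth(1)] p]] open_U p F])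
  then have "s * (c / s * c - 1 / s) + pdx (pdx r) p \<bullet> pdy (pdy r) p =
     - c * pdy \<phi> p * pdx \<phi> p - s * pdy (pdx \<phi>) p"
    by (simp add: rxxy gauss_weingarten(5)[OF p] inner_add_left inner_diff_left metric[OF p] normal[OF p]
       cot_def s_def c_def)
  moreover have "s * (c / s * c - 1 / s) = - s * s"
  proof -
    have "s * (c / s * c - 1 / s) = c * c - 1" using s by (simp add: field_simps)
    then show ?thesis by (simp add: c2)
  qed
  moreover have "pdx (pdx r) p \<bullet> pdy (pdy r) p = - c * pdx \<phi> p * pdy \<phi> p"
  proof -
    have "pdx (pdx r) p \<bullet> pdy (pdy r) p = pdx \<phi> p * pdy \<phi> p * (c * (c * c - 1)) / (s * s)"
      using s by (simp add: gauss_weingarten[OF p] inner_diff_left inner_diff_right metric[OF p] cot_def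
         s_def[symmetric] c_def[symmetric] field_simps)
    then show ?thesis using s by (simp add: c2)
  qed
  ultimately have "s * pdy (pdx \<phi>) p = s * s" by simp
  then show ?thesis using s by (simp add: s_def)
qed

section \<open>The tilde functions and the net built from them\<close>

lemma smooth_tilde_X: "smooth_on U \<Psi> \<Longrightarrow> smooth_on U (tilde_X \<phi> \<Psi>)"
  and smooth_tilde_Y: "smooth_on U \<Psi> \<Longrightarrow> smooth_on U (tilde_Y \<phi> \<Psi>)"
  unfolding tilde_X_def[abs_def] tilde_Y_def[abs_def] cot_def
  by (intro smooth_on_diff smooth_on_mult smooth_on_divide smooth_on_pdx smooth_on_pdy smooth_on_sin
      smooth_on_cos smooth open_U sin_nonzero; assumption)+

lemma cos_square: "cos (\<phi> p) * cos (\<phi> p) = 1 - sin (\<phi> p) * sin (\<phi> p)"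
  using sin_cos_squared_add2[of "\<phi> p"] by (simp add: power2_eq_square algebra_simps)

lemma partials_angle_deriv:
  assumes "p \<in> U"
  shows "has_partials (pdx \<phi>) (pdx (pdx \<phi>) p) (sin (\<phi> p)) p"
    "has_partials (pdy \<phi>) (sin (\<phi> p)) (pdy (pdy \<phi>) p) p"
  using smooth_on_has_partials[OF smooth_on_pdx[OF smooth(1)] assms] sine_gordon[OF assms]
    smooth_on_has_partials[OF smooth_on_pdy[OF smooth(1)] assms]
    smooth_on_mixed_partials[OF open_U smooth(1) assms] by auto

text \<open>Every mixed derivative is replaced by one of lower order; the third-order formulas come
  from differentiating the Moutard equation once.\<close>

lemma partials_moutard:
  assumes \<Psi>: "moutard_solution U \<phi> \<Psi>" and p: "p \<in> U"
  shows "has_partials \<Psi> (pdx \<Psi> p) (pdy \<Psi> p) p"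
    "has_partials (pdx \<Psi>) (pdx (pdx \<Psi>) p) (\<Psi> p * cos (\<phi> p)) p"
    "has_partials (pdy \<Psi>) (\<Psi> p * cos (\<phi> p)) (pdy (pdy \<Psi>) p) p"
    "pdy (pdx (pdx \<Psi>)) p = pdx \<Psi> p * cos (\<phi> p) - \<Psi> p * sin (\<phi> p) * pdx \<phi> p"
    "pdx (pdy (pdy \<Psi>)) p = pdy \<Psi> p * cos (\<phi> p) - \<Psi> p * sin (\<phi> p) * pdy \<phi> p"
proof -
  have s: "smooth_on U \<Psi>" and M: "\<And>q. q \<in> U \<Longrightarrow> pdy (pdx \<Psi>) q = \<Psi> q * cos (\<phi> q)"
    using \<Psi> by (auto simp: moutard_solution_def)
  note mixed = smooth_on_mixed_partials[OF open_U]
  show \<Psi>': "has_partials \<Psi> (pdx \<Psi> p) (pdy \<Psi> p) p"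
    by (rule smooth_on_has_partials[OF s p])
  show "has_partials (pdx \<Psi>) (pdx (pdx \<Psi>) p) (\<Psi> p * cos (\<phi> p)) p"
    "has_partials (pdy \<Psi>) (\<Psi> p * cos (\<phi> p)) (pdy (pdy \<Psi>) p) p"
    using smooth_on_has_partials[OF smooth_on_pdx[OF s] p] smooth_on_has_partials[OF smooth_on_pdy[OF s] p]
      M[OF p] mixed[OF s p] by auto
  note c = has_partials_mult[OF \<Psi>' has_partials_cos[OF partials_angle[OF p]]]
  have M': "pdx (pdy \<Psi>) q = \<Psi> q * cos (\<phi> q)" if "q \<in> U" for q
    using M mixed[OF s] that by simp
  have "pdx (pdy (pdx \<Psi>)) p = pdx \<Psi> p * cos (\<phi> p) + \<Psi> p * (- sin (\<phi> p) * pdx \<phi> p)"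
    by (rule has_partials_unique(1)[OF smooth_on_has_partials c open_U p M])
      (auto intro: smooth_on_pdx smooth_on_pdy s p)
  then show "pdy (pdx (pdx \<Psi>)) p = pdx \<Psi> p * cos (\<phi> p) - \<Psi> p * sin (\<phi> p) * pdx \<phi> p"
    using mixed[OF smooth_on_pdx[OF s] p] by simp
  have "pdy (pdx (pdy \<Psi>)) p = pdy \<Psi> p * cos (\<phi> p) + \<Psi> p * (- sin (\<phi> p) * pdy \<phi> p)"
    by (rule has_partials_unique(2)[OF smooth_on_has_partials c open_U p M'])
      (auto intro: smooth_on_pdx smooth_on_pdy s p)
  then show "pdx (pdy (pdy \<Psi>)) p = pdy \<Psi> p * cos (\<phi> p) - \<Psi> p * sin (\<phi> p) * pdy \<phi> p"
    using mixed[OF smooth_on_pdy[OF s] p] by simp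
qed

text \<open>In the first identity sine-Gordon turns the term with
  \<open>\<phi>\<^sub>x\<^sub>y\<close> into \<open>\<Psi>\<^sub>y\<close>, which cancels the
  derivative of \<open>- \<Psi>\<close>. In the second the terms
  \<open>\<Psi>\<^sub>y cos \<phi>\<close> cancel, and
  \<open>cos\<^sup>2 \<phi> + sin\<^sup>2 \<phi> = 1\<close> combines the terms with
  \<open>\<Psi>\<close>.\<close>

lemma tilde_codazzi:
  assumes \<Psi>: "moutard_solution U \<phi> \<Psi>" and p: "p \<in> U"
  shows "pdy (tilde_X \<phi> \<Psi>) p = - tilde_Y \<phi> \<Psi> p * pdx \<phi> p / sin (\<phi> p)" (is ?X)
    and "pdx (tilde_Y \<phi> \<Psi>) p = - tilde_X \<phi> \<Psi> p * pdy \<phi> p / sin (\<phi> p)" (is ?Y)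
proof -
  have s: "smooth_on U \<Psi>" using \<Psi> by (simp add: moutard_solution_def)
  define S C where "S = sin (\<phi> p)" and "C = cos (\<phi> p)"
  have S: "S \<noteq> 0" using sin_nonzero[OF p] by (simp add: S_def)
  have C2: "C * C = 1 - S * S" using cos_square[of p] by (simp add: S_def C_def)
  note P = partials_moutard[OF \<Psi> p]
  note \<phi> = partials_angle[OF p] partials_angle_deriv[OF p]
  have "pdy (tilde_X \<phi> \<Psi>) p =
     (S * S - pdx \<phi> p * (C * pdy \<phi> p)) / S\<^sup>2 * pdy \<Psi> p + pdx \<phi> p / S * pdy (pdy \<Psi>) p - pdy \<Psi> p"
    unfolding tilde_X_def[abs_def] S_def C_def
    by (rule has_partials_imp_pdy[OF has_partials_diff[OF has_partials_mult[OF has_partials_divide[OF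
            \<phi>(2) has_partials_sin[OF \<phi>(1)] sin_nonzero[OF p]] P(3)] P(1)]])
  then show ?X unfolding tilde_Y_def cot_def S_def[symmetric] C_def[symmetric]
    using S by (simp add: field_simps power2_eq_square)
  have "has_partials (\<lambda>p. pdy \<phi> p * (cos (\<phi> p) / sin (\<phi> p)) * pdy \<Psi> p - pdy (pdy \<Psi>) p)
    ((S * (C / S) + pdy \<phi> p * (((- S * pdx \<phi> p) * S - C * (C * pdx \<phi> p)) / S\<^sup>2)) * pdy \<Psi> p
       + pdy \<phi> p * (C / S) * (\<Psi> p * C) - pdx (pdy (pdy \<Psi>)) p)
    ((pdy (pdy \<phi>) p * (C / S) + pdy \<phi> p * (((- S * pdy \<phi> p) * S - C * (C * pdy \<phi> p)) / S\<^sup>2)) * pdy \<Psi> p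
       + pdy \<phi> p * (C / S) * pdy (pdy \<Psi>) p - pdy (pdy (pdy \<Psi>)) p) p"
    unfolding S_def C_def
    by (intro has_partials_diff has_partials_mult has_partials_divide has_partials_sin has_partials_cos \<phi>
        P(3) sin_nonzero[OF p] smooth_on_has_partials[OF _ p] smooth_on_pdy s)
  from has_partials_imp_pdx[OF this]
  have "pdx (tilde_Y \<phi> \<Psi>) p = (C + pdy \<phi> p * (- pdx \<phi> p * (S * S + C * C) / (S * S))) * pdy \<Psi> p
       + pdy \<phi> p * (C * C / S) * \<Psi> p - (pdy \<Psi> p * C - \<Psi> p * S * pdy \<phi> p)"
    unfolding tilde_Y_def[abs_def] cot_def P(5) S_def[symmetric] C_def[symmetric]
    using S by (simp add: field_simps power2_eq_square)
  also have "\<dots> = pdy \<phi> p * \<Psi> p / S - pdy \<phi> p * pdx \<phi> p / (S * S) * pdy \<Psi> p"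
    unfolding C2 using S by (simp add: field_simps)
  also have "\<dots> = - tilde_X \<phi> \<Psi> p * pdy \<phi> p / sin (\<phi> p)"
    unfolding tilde_X_def S_def[symmetric] using S by (simp add: field_simps)
  finally show ?Y .
qed

text \<open>The prescribed derivatives, as vector fields on all of \<open>U\<close>: they can be
  differentiated before any net with these derivatives is known to exist.\<close>

definition tilde_fx :: "(real \<times> real \<Rightarrow> real) \<Rightarrow> real \<times> real \<Rightarrow> real^3" where
  "tilde_fx \<Psi> p = (tilde_X \<phi> \<Psi> p / sin (\<phi> p)) *\<^sub>R pdy r p"

definition tilde_fy :: "(real \<times> real \<Rightarrow> real) \<Rightarrow> real \<times> real \<Rightarrow> real^3" where
  "tilde_fy \<Psi> p = (tilde_Y \<phi> \<Psi> p / sin (\<phi> p)) *\<^sub>R pdx r p"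

lemma tilde_net_iff:
  "tilde_net V \<phi> r \<Psi> f \<longleftrightarrow> smooth_on V f \<and> (\<forall>p\<in>V. pdx f p = tilde_fx \<Psi> p \<and> pdy f p = tilde_fy \<Psi> p)"
  by (simp add: tilde_net_def tilde_fx_def tilde_fy_def)

lemma smooth_tilde_fx: "smooth_on U \<Psi> \<Longrightarrow> smooth_on U (tilde_fx \<Psi>)"
  and smooth_tilde_fy: "smooth_on U \<Psi> \<Longrightarrow> smooth_on U (tilde_fy \<Psi>)"
  unfolding tilde_fx_def[abs_def] tilde_fy_def[abs_def]
  by (intro smooth_on_scaleR smooth_on_divide smooth_on_pdx smooth_on_pdy smooth_on_sin
      smooth open_U sin_nonzero smooth_tilde_X smooth_tilde_Y; assumption)+

text \<open>The common value \<open>w\<close> expresses closedness: the terms with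
  \<open>cot \<phi>\<close> cancel and \<open>tilde_codazzi\<close> rewrites the rest. The
  coefficients \<open>a\<close> and \<open>b\<close> stay unspecified because only the direction of
  the tangential part and the normal component matter for the forms and the geodesic
  curvature.\<close>

lemma partials_tilde:
  assumes \<Psi>: "moutard_solution U \<phi> \<Psi>" and p: "p \<in> U"
  defines "w \<equiv> - (tilde_X \<phi> \<Psi> p * pdy \<phi> p / (sin (\<phi> p))\<^sup>2) *\<^sub>R pdx r p
    - (tilde_Y \<phi> \<Psi> p * pdx \<phi> p / (sin (\<phi> p))\<^sup>2) *\<^sub>R pdy r p"
  shows "\<exists>a. has_partials (tilde_fx \<Psi>) (a *\<^sub>R pdy r p + tilde_X \<phi> \<Psi> p *\<^sub>R n p) w p"
    and "\<exists>b. has_partials (tilde_fy \<Psi>) w (b *\<^sub>R pdx r p + tilde_Y \<phi> \<Psi> p *\<^sub>R n p) p"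
proof -
  have s: "smooth_on U \<Psi>" using \<Psi> by (simp add: moutard_solution_def)
  define S C where "S = sin (\<phi> p)" and "C = cos (\<phi> p)"
  have S: "S \<noteq> 0" using sin_nonzero[OF p] by (simp add: S_def)
  note X = has_partials_divide[OF smooth_on_has_partials[OF smooth_tilde_X[OF s] p]
      has_partials_sin[OF partials_angle[OF p]] sin_nonzero[OF p]]
  note Y = has_partials_divide[OF smooth_on_has_partials[OF smooth_tilde_Y[OF s] p]
      has_partials_sin[OF partials_angle[OF p]] sin_nonzero[OF p]]
  note co = tilde_codazzi[OF \<Psi> p]
  have "has_partials (tilde_fx \<Psi>)
    (((pdx (tilde_X \<phi> \<Psi>) p * S - tilde_X \<phi> \<Psi> p * (C * pdx \<phi> p)) / S\<^sup>2) *\<^sub>R pdy r p + (tilde_X \<phi> \<Psi> p / S) *\<^sub>R S *\<^sub>R n p)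
    (((pdy (tilde_X \<phi> \<Psi>) p * S - tilde_X \<phi> \<Psi> p * (C * pdy \<phi> p)) / S\<^sup>2) *\<^sub>R pdy r p +
      (tilde_X \<phi> \<Psi> p / S) *\<^sub>R ((pdy \<phi> p * cot (\<phi> p)) *\<^sub>R pdy r p - (pdy \<phi> p / S) *\<^sub>R pdx r p)) p"
    unfolding tilde_fx_def[abs_def] S_def C_def by (rule has_partials_scaleR[OF X partials_frame(2)[OF p]])
  moreover have "((pdy (tilde_X \<phi> \<Psi>) p * S - tilde_X \<phi> \<Psi> p * (C * pdy \<phi> p)) / S\<^sup>2) *\<^sub>R pdy r p +
      (tilde_X \<phi> \<Psi> p / S) *\<^sub>R ((pdy \<phi> p * cot (\<phi> p)) *\<^sub>R pdy r p - (pdy \<phi> p / S) *\<^sub>R pdx r p) = w"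
    unfolding w_def co cot_def S_def[symmetric] C_def[symmetric]
    using S by (simp add: vec_eq_iff field_simps power2_eq_square)
  ultimately show "\<exists>a. has_partials (tilde_fx \<Psi>) (a *\<^sub>R pdy r p + tilde_X \<phi> \<Psi> p *\<^sub>R n p) w p"
    using S by auto
  have "has_partials (tilde_fy \<Psi>)
    (((pdx (tilde_Y \<phi> \<Psi>) p * S - tilde_Y \<phi> \<Psi> p * (C * pdx \<phi> p)) / S\<^sup>2) *\<^sub>R pdx r p +
      (tilde_Y \<phi> \<Psi> p / S) *\<^sub>R ((pdx \<phi> p * cot (\<phi> p)) *\<^sub>R pdx r p - (pdx \<phi> p / S) *\<^sub>R pdy r p))
    (((pdy (tilde_Y \<phi> \<Psi>) p * S - tilde_Y \<phi> \<Psi> p * (C * pdy \<phi> p)) / S\<^sup>2) *\<^sub>R pdx r p + (tilde_Y \<phi> \<Psi> p / S) *\<^sub>R S *\<^sub>R n p) p"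
    unfolding tilde_fy_def[abs_def] S_def C_def by (rule has_partials_scaleR[OF Y partials_frame(1)[OF p]])
  moreover have "((pdx (tilde_Y \<phi> \<Psi>) p * S - tilde_Y \<phi> \<Psi> p * (C * pdx \<phi> p)) / S\<^sup>2) *\<^sub>R pdx r p +
      (tilde_Y \<phi> \<Psi> p / S) *\<^sub>R ((pdx \<phi> p * cot (\<phi> p)) *\<^sub>R pdx r p - (pdx \<phi> p / S) *\<^sub>R pdy r p) = w"
    unfolding w_def co cot_def S_def[symmetric] C_def[symmetric]
    using S by (simp add: vec_eq_iff field_simps power2_eq_square)
  ultimately show "\<exists>b. has_partials (tilde_fy \<Psi>) w (b *\<^sub>R pdx r p + tilde_Y \<phi> \<Psi> p *\<^sub>R n p) p"
    using S by auto
qed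

lemma tilde_net_exists:
  assumes \<Psi>: "moutard_solution U \<phi> \<Psi>" and V: "open V" "convex V" "V \<subseteq> U"
  shows "\<exists>f. tilde_net V \<phi> r \<Psi> f"
proof -
  have "smooth_on U \<Psi>" using \<Psi> by (simp add: moutard_solution_def)
  then have s: "smooth_on V (tilde_fx \<Psi>)" "smooth_on V (tilde_fy \<Psi>)"
    using smooth_tilde_fx smooth_tilde_fy smooth_on_subset V(3) by blast+
  obtain f where f: "\<And>p. p \<in> V \<Longrightarrow> has_partials f (tilde_fx \<Psi> p) (tilde_fy \<Psi> p) p"
  proof (rule closed_form_has_potential[OF V(1,2), of "tilde_fx \<Psi>" "tilde_fy \<Psi>"])
    fix p assume "p \<in> V"
    then have "p \<in> U" using V(3) by auto
    from partials_tilde[OF \<Psi> this] show "pdy (tilde_fx \<Psi>) p = pdx (tilde_fy \<Psi>) p"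
      using has_partials_imp_pdx[of "tilde_fy \<Psi>"] has_partials_imp_pdy[of "tilde_fx \<Psi>"] by fastforce
  qed (use s in \<open>auto simp: smooth_on_def simp del: Ck_on.simps One_nat_def\<close>)
  have "tilde_net V \<phi> r \<Psi> f"
    unfolding tilde_net_iff
    using has_partials_imp_pdx[OF f] has_partials_imp_pdy[OF f] smooth_onI[OF V(1) f s] by blast
  then show ?thesis by blast
qed

text \<open>On the open set \<open>V\<close> the first derivatives of \<open>f\<close> agree with
  the fields \<open>tilde_fx\<close> and \<open>tilde_fy\<close>, so the derivatives of these fields
  carry over.\<close>

lemma second_partials_tilde_net:
  assumes \<Psi>: "moutard_solution U \<phi> \<Psi>" and V: "open V" "V \<subseteq> U" and f: "tilde_net V \<phi> r \<Psi> f" and p: "p \<in> V"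
  obtains a b u v where
    "pdx (pdx f) p = a *\<^sub>R pdy r p + tilde_X \<phi> \<Psi> p *\<^sub>R n p"
    "pdy (pdx f) p = u *\<^sub>R pdx r p + v *\<^sub>R pdy r p"
    "pdx (pdy f) p = u *\<^sub>R pdx r p + v *\<^sub>R pdy r p"
    "pdy (pdy f) p = b *\<^sub>R pdx r p + tilde_Y \<phi> \<Psi> p *\<^sub>R n p"
proof -
  define u where "u = - (tilde_X \<phi> \<Psi> p * pdy \<phi> p / (sin (\<phi> p))\<^sup>2)"
  define v where "v = - (tilde_Y \<phi> \<Psi> p * pdx \<phi> p / (sin (\<phi> p))\<^sup>2)"
  have "p \<in> U" using p V by auto
  from partials_tilde[OF \<Psi> this] obtain a b where
    "has_partials (tilde_fx \<Psi>) (a *\<^sub>R pdy r p + tilde_X \<phi> \<Psi> p *\<^sub>R n p) (u *\<^sub>R pdx r p + v *\<^sub>R pdy r p) p"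
    "has_partials (tilde_fy \<Psi>) (u *\<^sub>R pdx r p + v *\<^sub>R pdy r p) (b *\<^sub>R pdx r p + tilde_Y \<phi> \<Psi> p *\<^sub>R n p) p"
    by (auto simp: u_def v_def)
  then have 1: "has_partials (pdx f) (a *\<^sub>R pdy r p + tilde_X \<phi> \<Psi> p *\<^sub>R n p) (u *\<^sub>R pdx r p + v *\<^sub>R pdy r p) p"
    and 2: "has_partials (pdy f) (u *\<^sub>R pdx r p + v *\<^sub>R pdy r p) (b *\<^sub>R pdx r p + tilde_Y \<phi> \<Psi> p *\<^sub>R n p) p"
    using f unfolding tilde_net_iff by (auto elim!: has_partials_cong[OF _ V(1) p])
  show thesis
    by (rule that[OF has_partials_imp_pdx[OF 1] has_partials_imp_pdy[OF 1]
          has_partials_imp_pdx[OF 2] has_partials_imp_pdy[OF 2]])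
qed

lemma tilde_forms:
  assumes \<Psi>: "moutard_solution U \<phi> \<Psi>" and V: "open V" "V \<subseteq> U" and f: "tilde_net V \<phi> r \<Psi> f" and p: "p \<in> V"
  shows "first_form f p =
       quad_form ((tilde_X \<phi> \<Psi> p)\<^sup>2 / (sin (\<phi> p))\<^sup>2)
                 (tilde_X \<phi> \<Psi> p * tilde_Y \<phi> \<Psi> p * cos (\<phi> p) / (sin (\<phi> p))\<^sup>2)
                 ((tilde_Y \<phi> \<Psi> p)\<^sup>2 / (sin (\<phi> p))\<^sup>2)" (is ?I)
    and "second_form f n p = quad_form (tilde_X \<phi> \<Psi> p) 0 (tilde_Y \<phi> \<Psi> p)" (is ?II)
    and "det (first_form f p) = 0 \<longleftrightarrow> tilde_X \<phi> \<Psi> p * tilde_Y \<phi> \<Psi> p = 0" (is ?sing)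
proof -
  have pU: "p \<in> U" using p V by auto
  have d: "pdx f p = tilde_fx \<Psi> p" "pdy f p = tilde_fy \<Psi> p" using f p by (auto simp: tilde_net_iff)
  show I: ?I
    by (simp add: first_form_eq_quad_form d tilde_fx_def tilde_fy_def metric[OF pU] power2_eq_square
        quad_form_eq_iff ac_simps)
  show ?II
    by (rule second_partials_tilde_net[OF \<Psi> V f p])
      (simp add: second_form_def quad_form_def inner_add_left normal[OF pU])
  define X Y S C where "X = tilde_X \<phi> \<Psi> p" and "Y = tilde_Y \<phi> \<Psi> p" and "S = sin (\<phi> p)" and "C = cos (\<phi> p)"
  have S: "S \<noteq> 0" using sin_nonzero[OF pU] by (simp add: S_def)
  have C2: "C * C = 1 - S * S" using cos_square[of p] by (simp add: S_def C_def)
  have "det (first_form f p) = X\<^sup>2 / S\<^sup>2 * (Y\<^sup>2 / S\<^sup>2) - (X * Y * C / S\<^sup>2)\<^sup>2"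
    unfolding I det_quad_form X_def Y_def S_def C_def ..
  \<comment> \<open>The factor \<open>1 - C * C\<close> equals \<open>S * S\<close>, so the
    determinant becomes the square of \<open>X * Y / S\<close>.\<close>
  also have "\<dots> = (X * Y)\<^sup>2 * (1 - C * C) / (S * S * S * S)"
    using S by (simp add: field_simps power2_eq_square)
  also have "\<dots> = (X * Y)\<^sup>2 / (S * S)"
    unfolding C2 using S by (simp add: field_simps)
  finally show ?sing using S by (simp add: X_def Y_def)
qed

lemma tilde_voss_net:
  assumes \<Psi>: "moutard_solution U \<phi> \<Psi>" and V: "open V" "V \<subseteq> U" and f: "tilde_net V \<phi> r \<Psi> f"
    and "nonsingular_net V f"
  shows "voss_net V f n"
  unfolding voss_net_def
proof (intro conjI)
  have d: "pdx f p = tilde_fx \<Psi> p" "pdy f p = tilde_fy \<Psi> p" if "p \<in> V" for p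
    using f that by (auto simp: tilde_net_iff)
  show "unit_normal V f n"
    unfolding unit_normal_def using smooth_on_subset[OF smooth(3) V(2)] V(2) normal
    by (auto simp: d tilde_fx_def tilde_fy_def norm_eq_1 subset_iff)
  show "conjugate_net V f n"
    unfolding conjugate_net_def using tilde_forms(2)[OF \<Psi> V f] by (simp add: quad_form_def)
  show "geodesic_net V f n"
    unfolding geodesic_net_def
  proof (intro allI impI)
    fix x y assume p: "(x, y) \<in> V"
    \<comment> \<open>Along a coordinate line the two curve derivatives are iterated partials by
      definition.\<close>
    have x: "geodesic_curvature (\<lambda>s. f (s, y)) (n (x, y)) x =
        cross3 (pdx f (x, y)) (pdx (pdx f) (x, y)) \<bullet> n (x, y) / norm (pdx f (x, y)) ^ 3"
      and y: "geodesic_curvature (\<lambda>s. f (x, s)) (n (x, y)) y =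
        cross3 (pdy f (x, y)) (pdy (pdy f) (x, y)) \<bullet> n (x, y) / norm (pdy f (x, y)) ^ 3"
      by (simp_all add: geodesic_curvature_def pdx_def pdy_def Let_def)
    show "geodesic_curvature (\<lambda>s. f (s, y)) (n (x, y)) x = 0 \<and>
        geodesic_curvature (\<lambda>s. f (x, s)) (n (x, y)) y = 0"
      unfolding x y
      \<comment> \<open>The first derivative is parallel to one tangent vector of \<open>r\<close>,
        and the second lies in the span of that vector and the normal; hence the triple product with
        the normal vanishes.\<close>
      by (rule second_partials_tilde_net[OF \<Psi> V f p])
        (simp add: d[OF p] tilde_fx_def tilde_fy_def cross_add_right cross_mult_left cross_mult_right
          inner_add_left dot_cross_self)
  qed
qed fact

section \<open>The net associated with \<open>\<Phi>\<close> and the recursion operator\<close>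

lemma smooth_voss_q: "smooth_on U \<Phi> \<Longrightarrow> smooth_on U (voss_q \<phi> r n \<Phi>)"
  unfolding voss_q_def[abs_def]
  by (intro smooth_on_diff smooth_on_add smooth_on_scaleR smooth_on_divide smooth_on_const smooth_on_pdx
      smooth_on_pdy smooth_on_sin smooth open_U sin_nonzero; assumption)

text \<open>After insertion of Gauss-Weingarten and Moutard, the normal component and one tangential
  component of each derivative cancel.\<close>

lemma partials_voss_q:
  assumes \<Phi>: "moutard_solution U \<phi> \<Phi>" and p: "p \<in> U"
  shows "has_partials (voss_q \<phi> r n \<Phi>) (- (voss_X \<phi> \<Phi> p / sin (\<phi> p)) *\<^sub>R pdy r p)
    (- (voss_Y \<phi> \<Phi> p / sin (\<phi> p)) *\<^sub>R pdx r p) p"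
proof -
  define S C where "S = sin (\<phi> p)" and "C = cos (\<phi> p)"
  have S: "S \<noteq> 0" using sin_nonzero[OF p] by (simp add: S_def)
  note P = partials_moutard[OF \<Phi> p]
  note gw = partials_frame[OF p]
  note D = has_partials_diff[OF has_partials_scaleR[OF P(1) gw(3)] has_partials_scaleR[OF
    has_partials_divide[OF has_partials_const[of 1] has_partials_sin[OF partials_angle[OF p]] sin_nonzero[OF p]]
    has_partials_add[OF has_partials_scaleR[OF P(3) gw(1)] has_partials_scaleR[OF P(2) gw(2)]]]]
  have "pdx (voss_q \<phi> r n \<Phi>) p = - (voss_X \<phi> \<Phi> p / sin (\<phi> p)) *\<^sub>R pdy r p"
    unfolding voss_q_def[abs_def] has_partials_imp_pdx[OF D] voss_X_def cot_def S_def[symmetric] C_def[symmetric]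
    using S by (simp add: vec_eq_iff field_simps power2_eq_square)
  moreover have "pdy (voss_q \<phi> r n \<Phi>) p = - (voss_Y \<phi> \<Phi> p / sin (\<phi> p)) *\<^sub>R pdx r p"
    unfolding voss_q_def[abs_def] has_partials_imp_pdy[OF D] voss_Y_def cot_def S_def[symmetric] C_def[symmetric]
    using S by (simp add: vec_eq_iff field_simps power2_eq_square)
  ultimately show ?thesis
    using smooth_on_has_partials[OF smooth_voss_q[of \<Phi>] p] \<Phi> by (simp add: moutard_solution_def)
qed

text \<open>The terms with \<open>Q\<close> cancel, so the result does not depend on its additive
  constant. The minus signs match the opposite sign conventions for the derivatives of
  \<open>voss_q\<close> and of a \<open>tilde_net\<close>.\<close>

lemma recursion_step:
  assumes \<Phi>: "moutard_solution U \<phi> \<Phi>" and R: "recursion_value U \<phi> \<Phi> R"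
    and \<Psi>: "\<And>p. p \<in> U \<Longrightarrow> \<Psi> p = R p + \<Phi> p"
  shows "moutard_solution U \<phi> \<Psi>"
    and "\<And>p. p \<in> U \<Longrightarrow> tilde_X \<phi> \<Psi> p = - voss_X \<phi> \<Phi> p"
    and "\<And>p. p \<in> U \<Longrightarrow> tilde_Y \<phi> \<Psi> p = - voss_Y \<phi> \<Phi> p"
proof -
  have s: "smooth_on U \<Phi>" using \<Phi> by (simp add: moutard_solution_def)
  obtain Q where Q: "smooth_on U Q" "\<And>p. p \<in> U \<Longrightarrow> pdx Q p = pdx \<Phi> p * pdx \<phi> p"
    "\<And>p. p \<in> U \<Longrightarrow> pdy Q p = \<Phi> p * sin (\<phi> p)"
    "\<And>p. p \<in> U \<Longrightarrow> R p = pdx (pdx \<Phi>) p + pdx \<phi> p * Q p"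
    using R unfolding recursion_value_def by blast
  have eq: "pdx (pdx \<Phi>) p + pdx \<phi> p * Q p + \<Phi> p = \<Psi> p" if "p \<in> U" for p
    using Q(4) \<Psi> that by simp
  have s\<Psi>: "smooth_on U \<Psi>"
    by (rule smooth_on_cong[OF _ open_U eq])
      (intro smooth_on_add smooth_on_mult smooth_on_pdx open_U s smooth Q; assumption)
  have Q': "has_partials Q (pdx \<Phi> p * pdx \<phi> p) (\<Phi> p * sin (\<phi> p)) p" if "p \<in> U" for p
    using smooth_on_has_partials[OF Q(1) that] Q(2,3)[OF that] by simp
  note P = partials_moutard[OF \<Phi>]
  \<comment> \<open>By the Moutard equation the third derivative of \<open>\<Phi>\<close>
    contributes \<open>- \<Phi> sin \<phi> \<phi>\<^sub>x\<close>, which cancels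
    \<open>\<phi>\<^sub>x Q\<^sub>y\<close>; sine-Gordon turns
    \<open>\<phi>\<^sub>x\<^sub>y Q\<close> into \<open>sin \<phi> Q\<close>.\<close>
  have \<Psi>y: "pdy \<Psi> p = pdx \<Phi> p * cos (\<phi> p) + sin (\<phi> p) * Q p + pdy \<Phi> p" if p: "p \<in> U" for p
  proof -
    have "pdy \<Psi> p = pdy (pdx (pdx \<Phi>)) p + (sin (\<phi> p) * Q p + pdx \<phi> p * (\<Phi> p * sin (\<phi> p))) + pdy \<Phi> p"
      by (rule has_partials_imp_pdy[OF has_partials_cong[OF has_partials_add[OF has_partials_add[OF
            smooth_on_has_partials[OF smooth_on_pdx[OF smooth_on_pdx[OF s]] p]
            has_partials_mult[OF partials_angle_deriv(1)[OF p] Q'[OF p]]] P(1)[OF p]] open_U p eq]])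
    then show ?thesis by (simp add: P(4)[OF p])
  qed
  \<comment> \<open>The \<open>x\<close>-part yields the Moutard equation for \<open>\<Psi>\<close>,
    where the terms with \<open>\<Phi>\<^sub>x \<phi>\<^sub>x\<close> cancel; the
    \<open>y\<close>-part yields the second derivative entering \<open>tilde_Y\<close>.\<close>
  have \<Psi>y': "has_partials (pdy \<Psi>)
      (pdx (pdx \<Phi>) p * cos (\<phi> p) + pdx \<Phi> p * (- sin (\<phi> p) * pdx \<phi> p) +
        (cos (\<phi> p) * pdx \<phi> p * Q p + sin (\<phi> p) * (pdx \<Phi> p * pdx \<phi> p)) + \<Phi> p * cos (\<phi> p))
      (\<Phi> p * cos (\<phi> p) * cos (\<phi> p) + pdx \<Phi> p * (- sin (\<phi> p) * pdy \<phi> p) +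
        (cos (\<phi> p) * pdy \<phi> p * Q p + sin (\<phi> p) * (\<Phi> p * sin (\<phi> p))) + pdy (pdy \<Phi>) p) p"
    if p: "p \<in> U" for p
    by (rule has_partials_cong[OF has_partials_add[OF has_partials_add[OF
          has_partials_mult[OF P(2)[OF p] has_partials_cos[OF partials_angle[OF p]]]
          has_partials_mult[OF has_partials_sin[OF partials_angle[OF p]] Q'[OF p]]] P(3)[OF p]]
        open_U p \<Psi>y[symmetric]])
  show "moutard_solution U \<phi> \<Psi>"
    unfolding moutard_solution_def
  proof (intro conjI s\<Psi> ballI)
    fix p assume p: "p \<in> U"
    show "pdy (pdx \<Psi>) p = \<Psi> p * cos (\<phi> p)"
      unfolding smooth_on_mixed_partials[OF open_U s\<Psi> p] has_partials_imp_pdx[OF \<Psi>y'[OF p]] eq[OF p, symmetric]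
      by (simp add: algebra_simps)
  qed
  fix p assume p: "p \<in> U"
  define S C where "S = sin (\<phi> p)" and "C = cos (\<phi> p)"
  have S: "S \<noteq> 0" using sin_nonzero[OF p] by (simp add: S_def)
  have C2: "C * C = 1 - S * S" using cos_square[of p] by (simp add: S_def C_def)
  show "tilde_X \<phi> \<Psi> p = - voss_X \<phi> \<Phi> p"
    unfolding tilde_X_def voss_X_def \<Psi>y[OF p] eq[OF p, symmetric] cot_def S_def[symmetric] C_def[symmetric]
    using S by (simp add: field_simps)
  have "\<Phi> p * C * C = \<Phi> p * (1 - S * S)"
    by (simp only: C2 mult.assoc)
  then have \<Psi>yy: "pdy (pdy \<Psi>) p = \<Phi> p - pdx \<Phi> p * S * pdy \<phi> p + C * pdy \<phi> p * Q p + pdy (pdy \<Phi>) p"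
    unfolding has_partials_imp_pdy[OF \<Psi>y'[OF p]] S_def[symmetric] C_def[symmetric]
    by (simp add: algebra_simps)
  have "tilde_Y \<phi> \<Psi> p + voss_Y \<phi> \<Phi> p = pdy \<phi> p * pdx \<Phi> p * (C * C + S * S - 1) / S"
    unfolding tilde_Y_def voss_Y_def \<Psi>y[OF p] \<Psi>yy cot_def S_def[symmetric] C_def[symmetric]
    using S by (simp add: field_simps)
  then show "tilde_Y \<phi> \<Psi> p = - voss_Y \<phi> \<Phi> p" by (simp add: C2)
qed

text \<open>The geometric content of the sign relation: the net of \<open>\<Phi>\<close> is itself a
  net for \<open>\<Psi>\<close>, explicitly and on all of \<open>U\<close>.\<close>

lemma tilde_net_voss_q:
  assumes "moutard_solution U \<phi> \<Phi>" "recursion_value U \<phi> \<Phi> R" "\<And>p. p \<in> U \<Longrightarrow> \<Psi> p = R p + \<Phi> p"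
  shows "tilde_net U \<phi> r \<Psi> (voss_q \<phi> r n \<Phi>)"
proof -
  have "smooth_on U \<Phi>" using assms(1) by (simp add: moutard_solution_def)
  then show ?thesis
    unfolding tilde_net_def
    using has_partials_imp_pdx[OF partials_voss_q[OF assms(1)]] has_partials_imp_pdy[OF partials_voss_q[OF assms(1)]]
      recursion_step(2,3)[OF assms] smooth_voss_q by simp
qed

end

theorem proposition8p1:
  fixes U :: "(real \<times> real) set"
    and \<phi> :: "real \<times> real \<Rightarrow> real"
    and r n :: "real \<times> real \<Rightarrow> real^3"
  assumes "open U"
    and "pseudospherical U \<phi> r n"
  shows "(\<forall>\<Psi>. moutard_solution U \<phi> \<Psi> \<longrightarrow>
            (\<forall>V. open V \<and> convex V \<and> V \<subseteq> U \<longrightarrow> (\<exists>f. tilde_net V \<phi> r \<Psi> f)) \<and>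
            (\<forall>V f. open V \<and> V \<subseteq> U \<and> tilde_net V \<phi> r \<Psi> f \<longrightarrow>
               (nonsingular_net V f \<longrightarrow> voss_net V f n) \<and>
               (\<forall>p\<in>V.
                  first_form f p =
                    quad_form ((tilde_X \<phi> \<Psi> p)\<^sup>2 / (sin (\<phi> p))\<^sup>2)
                              (tilde_X \<phi> \<Psi> p * tilde_Y \<phi> \<Psi> p * cos (\<phi> p) / (sin (\<phi> p))\<^sup>2)
                              ((tilde_Y \<phi> \<Psi> p)\<^sup>2 / (sin (\<phi> p))\<^sup>2) \<and>
                  second_form f n p = quad_form (tilde_X \<phi> \<Psi> p) 0 (tilde_Y \<phi> \<Psi> p) \<and>
                  (det (first_form f p) = 0 \<longleftrightarrow> tilde_X \<phi> \<Psi> p * tilde_Y \<phi> \<Psi> p = 0)))) \<and>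
         (\<forall>\<Phi> R \<Psi>. moutard_solution U \<phi> \<Phi> \<and> recursion_value U \<phi> \<Phi> R \<and>
            (\<forall>p\<in>U. \<Psi> p = R p + \<Phi> p) \<longrightarrow>
              moutard_solution U \<phi> \<Psi> \<and>
              tilde_net U \<phi> r \<Psi> (voss_q \<phi> r n \<Phi>) \<and>
              (\<forall>p\<in>U. tilde_X \<phi> \<Psi> p = - voss_X \<phi> \<Phi> p \<and>
                      tilde_Y \<phi> \<Psi> p = - voss_Y \<phi> \<Phi> p))"
proof -
  interpret pseudospherical_surface U \<phi> r n
    using assms by unfold_locales
  show ?thesis
    by (intro conjI allI impI ballI; elim conjE;
        (rule tilde_net_exists tilde_voss_net tilde_forms recursion_step tilde_net_voss_q;
          (assumption | erule (1) bspec)))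
qed

end
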